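(* Let $n,q,m\ge 1$ be integers and let $K$ be a field in which $n!\,q$ is invertible and which contains a primitive $q$th root of $1$. Let $G=G(n,q)\subset GL(n,K)$, $V=K^n$, and let $\varphi(q):\mathcal{F}(q)=K[t(w)\mid w\in\mathcal{M}(q)]\to K[V^m]^{G(n,q)}$ be the $K$-algebra homomorphism with $t(w)\mapsto [w]$. Then: (i) The kernel of $\varphi(q)$ is the ideal of $\mathcal{F}(q)$ generated by the elements $\Psi(w_1,\ldots,w_{n+1})$, where $w_1,\ldots,w_{n+1}\in\mathcal{M}(q)$. (ii) The algebra $K[V^m]^{G(n,q)}$ is minimally generated by the elements $[w]$, where $w\in\mathcal{M}(q)$ with $\deg(w)\le nq$ (that is, these elements generate the $K$-algebra, and no proper subset of them does).
   Context: $G(n,q)$ is the subgroup of $GL(n,K)$ consisting of the monomial matrices (exactly one non-zero entry in each row and column) whose non-zero entries are $q$th roots of $1$. It acts naturally on $V=K^n$ and diagonally on $V^m=V\oplus\cdots\oplus V$. $K[V^m]$ is the polynomial ring over $K$ in the $mn$ variables $x(i)_j$ ($1\le i\le m$, $1\le j\le n$), where $x(i)_j$ is the $j$th coordinate of the $i$th vector component, and $K[V^m]^{G}$ is the subalgebra of polynomial invariants for the induced action. Let $x(1),\ldots,x(m)$ be commuting variables; $\mathcal{M}(q)$ is the set of monomials $\neq 1$ in $x(1),\ldots,x(m)$ whose total degree is divisible by $q$. For $w=x(1)^{\alpha_1}\cdots x(m)^{\alpha_m}\in\mathcal{M}(q)$ put $w_{\langle j\rangle}=x(1)_j^{\alpha_1}\cdots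 x(m)_j^{\alpha_m}$ and $[w]=\sum_{j=1}^n w_{\langle j\rangle}\in K[V^m]^{G(n,q)}$. $\mathcal{F}(q)=K[t(w)\mid w\in\mathcal{M}(q)]$ is the polynomial ring in independent commuting variables $t(w)$, one for each $w\in\mathcal{M}(q)$. For $w_1,\ldots,w_{n+1}\in\mathcal{M}(q)$ (not necessarily distinct), $$\Psi(w_1,\ldots,w_{n+1})=\sum_{\lambda}(-1)^{h(\lambda)}\prod_{i=1}^{h(\lambda)}\Bigl((|\lambda_i|-1)!\cdot t\bigl(\textstyle\prod_{s\in\lambda_i}w_s\bigr)\Bigr)\in\mathcal{F}(q),$$ where $\lambda=\lambda_1\cup\cdots\cup\lambda_{h(\lambda)}$ runs over all partitions of the set $\{1,\ldots,n+1\}$ into disjoint non-empty subsets and $h(\lambda)$ is the number of parts. *)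

theory Defs
  imports
    "HOL-Analysis.Finite_Cartesian_Product"
    "HOL-Library.Poly_Mapping"
    "HOL-Library.Disjoint_Sets"
    "HOL-Algebra.RingHom"
    "HOL-Algebra.Generated_Rings"
begin

section \<open>Polynomial rings in arbitrarily many variables\<close>

text \<open>A monomial in variables from \<open>'x\<close> is its finitely supported exponent vector,
  so the product of monomials is written additively and \<open>0\<close> is the monomial \<open>1\<close>.\<close>

type_synonym 'x monom = "'x \<Rightarrow>\<^sub>0 nat"
type_synonym ('x, 'k) mpoly = "'x monom \<Rightarrow>\<^sub>0 'k"

definition mdeg :: "'x monom \<Rightarrow> nat" where
  "mdeg a = (\<Sum>x\<in>Poly_Mapping.keys a. Poly_Mapping.lookup a x)"

definition mconst :: "'k \<Rightarrow> ('x, 'k::zero) mpoly" where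
  "mconst c = Poly_Mapping.single 0 c"

definition mvar :: "'x \<Rightarrow> ('x, 'k::zero_neq_one) mpoly" where
  "mvar x = Poly_Mapping.single (Poly_Mapping.single x 1) 1"

text \<open>Substitution of \<open>\<sigma> x\<close> for each variable \<open>x\<close>; see \<open>msubst_hom\<close> below: this is the
  \<open>K\<close>-algebra homomorphism determined by \<open>\<sigma>\<close>.\<close>

definition msubst :: "('x \<Rightarrow> ('y, 'k) mpoly) \<Rightarrow> ('x, 'k::comm_ring_1) mpoly \<Rightarrow> ('y, 'k) mpoly" where
  "msubst \<sigma> f = (\<Sum>a\<in>Poly_Mapping.keys f. mconst (Poly_Mapping.lookup f a) * (\<Prod>x\<in>Poly_Mapping.keys a. \<sigma> x ^ Poly_Mapping.lookup a x))"

text \<open>A subring of a type-class ring, as a ring in the sense of HOL-Algebra.\<close>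

definition ring_on :: "'a::comm_ring_1 set \<Rightarrow> 'a ring" where
  "ring_on C = \<lparr>carrier = C, mult = (*), one = 1, zero = 0, add = (+)\<rparr>"

definition mpoly_ring :: "'x set \<Rightarrow> ('x, 'k::comm_ring_1) mpoly ring" where
  "mpoly_ring X = ring_on {f. \<forall>a\<in>Poly_Mapping.keys f. Poly_Mapping.keys a \<subseteq> X}"

definition alg_generated :: "('x, 'k::comm_ring_1) mpoly ring \<Rightarrow> ('x, 'k) mpoly set \<Rightarrow> ('x, 'k) mpoly set" where
  "alg_generated R S = generate_ring R (range mconst \<union> S)"

definition primitive_root_of_unity :: "nat \<Rightarrow> 'k::comm_ring_1 \<Rightarrow> bool" where
  "primitive_root_of_unity q \<zeta> \<longleftrightarrow> \<zeta> ^ q = 1 \<and> (\<forall>k. 0 < k \<and> k < q \<longrightarrow> \<zeta> ^ k \<noteq> 1)"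


section \<open>The group \<open>G(n,q)\<close> and its vector invariants\<close>

definition monomial_matrix :: "'k::zero^'n^'n \<Rightarrow> bool" where
  "monomial_matrix A \<longleftrightarrow> (\<forall>i. \<exists>!j. A $ i $ j \<noteq> 0) \<and> (\<forall>j. \<exists>!i. A $ i $ j \<noteq> 0)"

definition Gnq :: "nat \<Rightarrow> ('k::field^'n^'n) set" where
  "Gnq q = {A. invertible A \<and> monomial_matrix A \<and> (\<forall>i j. A $ i $ j \<noteq> 0 \<longrightarrow> (A $ i $ j) ^ q = 1)}"

text \<open>The variable \<open>x(i)\<^sub>j\<close> of \<open>K[V\<^sup>m]\<close> is \<open>mvar (i, j)\<close>. For a matrix \<open>A\<close>, \<open>pullback A f\<close> is
  \<open>v \<mapsto> f (A v)\<close> with \<open>A\<close> acting diagonally on \<open>V\<^sup>m\<close>, i.e. the action of \<open>A\<^sup>-\<^sup>1\<close> on \<open>f\<close>.\<close>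

definition pullback :: "'k::comm_ring_1^'n^'n \<Rightarrow> ('m \<times> 'n, 'k) mpoly \<Rightarrow> ('m \<times> 'n, 'k) mpoly" where
  "pullback A = msubst (\<lambda>(i, j). \<Sum>k\<in>UNIV. mconst (A $ j $ k) * mvar (i, k))"

definition invariant_ring :: "('k::comm_ring_1^'n^'n) set \<Rightarrow> ('m \<times> 'n, 'k) mpoly ring" where
  "invariant_ring G = ring_on {f. \<forall>A\<in>G. pullback A f = f}"

definition Mq :: "nat \<Rightarrow> 'm monom set" where
  "Mq q = {w. w \<noteq> 0 \<and> q dvd mdeg w}"

definition at_index :: "'m monom \<Rightarrow> 'n \<Rightarrow> ('m \<times> 'n, 'k::comm_ring_1) mpoly" where
  "at_index w j = (\<Prod>i\<in>Poly_Mapping.keys w. mvar (i, j) ^ Poly_Mapping.lookup w i)"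

definition bracket :: "'m monom \<Rightarrow> ('m \<times> 'n::finite, 'k::comm_ring_1) mpoly" where
  "bracket w = (\<Sum>j\<in>UNIV. at_index w j)"


section \<open>The presentation\<close>

text \<open>The variable \<open>t(w)\<close> of \<open>\<F>(q)\<close> is \<open>mvar w\<close>.\<close>

definition Fq :: "nat \<Rightarrow> ('m monom, 'k::comm_ring_1) mpoly ring" where
  "Fq q = mpoly_ring (Mq q)"

text \<open>\<open>phi\<close> is defined on polynomials in all \<open>t(w)\<close>; \<open>\<phi>(q)\<close> is its restriction to \<open>\<F>(q)\<close>
  (see \<open>phi_hom\<close>, \<open>phi_mvar\<close>, \<open>phi_mconst\<close>).\<close>

definition phi :: "('m monom, 'k::comm_ring_1) mpoly \<Rightarrow> ('m \<times> 'n::finite, 'k) mpoly" where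
  "phi = msubst bracket"

text \<open>\<open>Psi N w\<close> is \<open>\<Psi>(w\<^sub>1,\<dots>,w\<^sub>N)\<close>.\<close>

definition Psi :: "nat \<Rightarrow> (nat \<Rightarrow> 'm monom) \<Rightarrow> ('m monom, 'k::comm_ring_1) mpoly" where
  "Psi N w = (\<Sum>P | partition_on {1..N} P.
     (-1) ^ card P * (\<Prod>B\<in>P. of_nat (fact (card B - 1)) * mvar (\<Sum>s\<in>B. w s)))"


section \<open>Well-definedness\<close>

lemma mconst_simps [simp]:
  "mconst 0 = 0" "mconst 1 = 1"
  "mconst (c + d) = mconst c + mconst d" "mconst (c' * d') = mconst c' * mconst d'"
  for c d :: "'k::comm_monoid_add" and c' d' :: "'a::comm_ring_1"
  by (simp_all add: mconst_def single_add mult_single)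

lemma mconst_power: "mconst (c ^ n) = mconst c ^ n" for c :: "'k::comm_ring_1"
  by (induction n) simp_all

lemma mpow_add:
  fixes \<sigma> :: "'x \<Rightarrow> 'a::comm_ring_1"
  shows "(\<Prod>x\<in>Poly_Mapping.keys (a + b). \<sigma> x ^ Poly_Mapping.lookup (a + b) x)
    = (\<Prod>x\<in>Poly_Mapping.keys a. \<sigma> x ^ Poly_Mapping.lookup a x) * (\<Prod>x\<in>Poly_Mapping.keys b. \<sigma> x ^ Poly_Mapping.lookup b x)"
proof -
  let ?U = "Poly_Mapping.keys a \<union> Poly_Mapping.keys b"
  have ext: "(\<Prod>x\<in>Poly_Mapping.keys c. \<sigma> x ^ Poly_Mapping.lookup c x) = (\<Prod>x\<in>?U. \<sigma> x ^ Poly_Mapping.lookup c x)"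
    if "Poly_Mapping.keys c \<subseteq> ?U" for c
    using that by (intro prod.mono_neutral_left) (auto simp: in_keys_iff)
  show ?thesis
    unfolding ext[OF Poly_Mapping.keys_add] ext[OF Un_upper1] ext[OF Un_upper2]
    by (simp add: lookup_add power_add prod.distrib)
qed

lemma msubst_single:
  "msubst \<sigma> (Poly_Mapping.single a c) = mconst c * (\<Prod>x\<in>Poly_Mapping.keys a. \<sigma> x ^ Poly_Mapping.lookup a x)"
  by (simp add: msubst_def)

lemma msubst_superset:
  assumes "finite U" "Poly_Mapping.keys f \<subseteq> U"
  shows "msubst \<sigma> f = (\<Sum>a\<in>U. mconst (Poly_Mapping.lookup f a) * (\<Prod>x\<in>Poly_Mapping.keys a. \<sigma> x ^ Poly_Mapping.lookup a x))"
  unfolding msubst_def using assms by (intro sum.mono_neutral_left) (auto simp: in_keys_iff)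

lemma msubst_add: "msubst \<sigma> (f + g) = msubst \<sigma> f + msubst \<sigma> g"
proof -
  let ?U = "Poly_Mapping.keys f \<union> Poly_Mapping.keys g"
  show ?thesis
    using Poly_Mapping.keys_add[of f g]
    by (simp add: msubst_superset[of ?U] lookup_add sum.distrib distrib_right)
qed

lemma msubst_0 [simp]: "msubst \<sigma> 0 = 0"
  by (simp add: msubst_def)

lemma msubst_mconst: "msubst \<sigma> (mconst c) = mconst c"
  unfolding mconst_def[of c] msubst_single by (simp add: mconst_def)

lemma msubst_1 [simp]: "msubst \<sigma> 1 = 1"
  using msubst_mconst[of \<sigma> 1] by simp

lemma msubst_mvar: "msubst \<sigma> (mvar x) = \<sigma> x"
  by (simp add: mvar_def msubst_single)

lemma msubst_sum: "msubst \<sigma> (sum f A) = (\<Sum>a\<in>A. msubst \<sigma> (f a))"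
  by (induction A rule: infinite_finite_induct) (simp_all add: msubst_add)

lemma sum_monomials: "(\<Sum>a\<in>Poly_Mapping.keys f. Poly_Mapping.single a (Poly_Mapping.lookup f a)) = f"
proof (rule poly_mapping_eqI)
  fix b
  have "Poly_Mapping.lookup (\<Sum>a\<in>Poly_Mapping.keys f. Poly_Mapping.single a (Poly_Mapping.lookup f a)) b
      = (\<Sum>a\<in>Poly_Mapping.keys f. if a = b then Poly_Mapping.lookup f b else 0)"
    unfolding lookup_sum by (intro sum.cong) (auto simp: lookup_single)
  then show "Poly_Mapping.lookup (\<Sum>a\<in>Poly_Mapping.keys f. Poly_Mapping.single a (Poly_Mapping.lookup f a)) b
      = Poly_Mapping.lookup f b"
    by (simp add: in_keys_iff)
qed

lemma msubst_mult: "msubst \<sigma> (f * g) = msubst \<sigma> f * msubst \<sigma> g"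
proof -
  have *: "msubst \<sigma> (Poly_Mapping.single a c * Poly_Mapping.single b d)
      = msubst \<sigma> (Poly_Mapping.single a c) * msubst \<sigma> (Poly_Mapping.single b d)" for a b c d
    by (simp add: mult_single msubst_single mpow_add ac_simps)
  have f: "f = (\<Sum>a\<in>Poly_Mapping.keys f. Poly_Mapping.single a (Poly_Mapping.lookup f a))"
    and g: "g = (\<Sum>a\<in>Poly_Mapping.keys g. Poly_Mapping.single a (Poly_Mapping.lookup g a))"
    by (simp_all add: sum_monomials)
  show ?thesis
    by (subst (1 2) f, subst (1 2) g) (simp add: msubst_sum sum_product *)
qed

lemma msubst_uminus: "msubst \<sigma> (- f) = - msubst \<sigma> f"
  using msubst_add[of \<sigma> f "- f"] by (simp add: eq_neg_iff_add_eq_0 add.commute)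

lemma msubst_power: "msubst \<sigma> (f ^ n) = msubst \<sigma> f ^ n"
  by (induction n) (simp_all add: msubst_mult)

lemma msubst_prod: "msubst \<sigma> (prod f A) = (\<Prod>a\<in>A. msubst \<sigma> (f a))"
  by (induction A rule: infinite_finite_induct) (simp_all add: msubst_mult)

lemma msubst_hom: "msubst \<sigma> \<in> ring_hom (mpoly_ring UNIV) (mpoly_ring UNIV)"
  by (auto simp: ring_hom_def mpoly_ring_def ring_on_def msubst_add msubst_mult)

lemma ring_on_cring:
  assumes "1 \<in> C" "\<And>x. x \<in> C \<Longrightarrow> - x \<in> C"
    "\<And>x y. x \<in> C \<Longrightarrow> y \<in> C \<Longrightarrow> x + y \<in> C" "\<And>x y. x \<in> C \<Longrightarrow> y \<in> C \<Longrightarrow> x * y \<in> C"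
  shows "cring (ring_on C)"
proof (rule cringI)
  have 0: "0 \<in> C" using assms(1,2) assms(3)[of 1 "-1"] by simp
  show "abelian_group (ring_on C)"
  proof (rule abelian_groupI)
    fix x assume "x \<in> carrier (ring_on C)"
    then show "\<exists>y\<in>carrier (ring_on C). y \<oplus>\<^bsub>ring_on C\<^esub> x = \<zero>\<^bsub>ring_on C\<^esub>"
      using assms(2) by (intro bexI[of _ "- x"]) (auto simp: ring_on_def)
  qed (use 0 assms in \<open>auto simp: ring_on_def ac_simps\<close>)
  show "Group.comm_monoid (ring_on C)"
    by (rule comm_monoidI) (use assms in \<open>auto simp: ring_on_def ac_simps\<close>)
qed (auto simp: ring_on_def distrib_right)

lemma mpoly_ring_cring: "cring (mpoly_ring X :: ('x, 'k::comm_ring_1) mpoly ring)"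
  unfolding mpoly_ring_def
proof (rule ring_on_cring)
  fix f g :: "('x, 'k) mpoly"
  assume f: "f \<in> {f. \<forall>a\<in>Poly_Mapping.keys f. Poly_Mapping.keys a \<subseteq> X}" and g: "g \<in> {f. \<forall>a\<in>Poly_Mapping.keys f. Poly_Mapping.keys a \<subseteq> X}"
  show "f + g \<in> {f. \<forall>a\<in>Poly_Mapping.keys f. Poly_Mapping.keys a \<subseteq> X}"
    using f g Poly_Mapping.keys_add[of f g] by auto
  show "f * g \<in> {f. \<forall>a\<in>Poly_Mapping.keys f. Poly_Mapping.keys a \<subseteq> X}"
  proof (intro CollectI ballI)
    fix c assume "c \<in> Poly_Mapping.keys (f * g)"
    then obtain a b where "a \<in> Poly_Mapping.keys f" "b \<in> Poly_Mapping.keys g" "c = a + b"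
      using keys_mult[of f g] by auto
    then show "Poly_Mapping.keys c \<subseteq> X"
      using f g Poly_Mapping.keys_add[of a b] by blast
  qed
qed (auto simp: keys_one)

lemma invariant_ring_cring: "cring (invariant_ring G)"
  unfolding invariant_ring_def
  by (rule ring_on_cring) (auto simp: pullback_def msubst_add msubst_mult msubst_uminus)

lemma pullback_bracket:
  fixes A :: "'k::field^'n^'n"
  assumes A: "A \<in> Gnq q" and w: "q dvd mdeg w"
  shows "pullback A (bracket w) = (bracket w :: ('m \<times> 'n, 'k) mpoly)"
proof -
  define s where "s j = (THE k. A $ j $ k \<noteq> 0)" for j
  have ex1: "\<exists>!k. A $ j $ k \<noteq> 0" "\<exists>!k. A $ k $ j \<noteq> 0" for j
    using A by (auto simp: Gnq_def monomial_matrix_def)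
  have s: "A $ j $ k \<noteq> 0 \<longleftrightarrow> k = s j" for j k
    using theI'[OF ex1(1)[of j]] ex1(1)[of j] by (auto simp: s_def)
  have "inj s"
    by (rule injI) (metis s ex1(2))
  then have bij: "bij s"
    by (simp add: bij_def finite_UNIV_inj_surj)
  have row: "(\<Sum>k\<in>UNIV. mconst (A $ j $ k) * mvar (i, k))
      = mconst (A $ j $ s j) * (mvar (i, s j) :: ('m \<times> 'n, 'k) mpoly)" for i j
    by (subst sum.remove[of _ "s j"]) (auto intro!: sum.neutral, metis s mconst_simps(1) mult_zero_left)
  have one: "mconst (A $ j $ s j) ^ mdeg w = (1 :: ('m \<times> 'n, 'k) mpoly)" for j
  proof -
    have "(A $ j $ s j) ^ q = 1" using A s by (auto simp: Gnq_def)
    then have "(A $ j $ s j) ^ mdeg w = 1" using w by (auto simp: power_mult elim!: dvdE)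
    then show ?thesis by (metis mconst_power mconst_simps(2))
  qed
  have "pullback A (at_index w j) = (at_index w (s j) :: ('m \<times> 'n, 'k) mpoly)" for j
  proof -
    have "pullback A (at_index w j)
        = (\<Prod>i\<in>Poly_Mapping.keys w. (mconst (A $ j $ s j) * (mvar (i, s j) :: ('m \<times> 'n, 'k) mpoly)) ^ Poly_Mapping.lookup w i)"
      by (simp add: pullback_def at_index_def msubst_prod msubst_power msubst_mvar row)
    also have "\<dots> = mconst (A $ j $ s j) ^ mdeg w * at_index w (s j)"
      by (simp add: power_mult_distrib prod.distrib at_index_def mdeg_def power_sum)
    finally show ?thesis by (simp add: one)
  qed
  then have "pullback A (bracket w) = (\<Sum>j\<in>UNIV. at_index w (s j) :: ('m \<times> 'n, 'k) mpoly)"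
    by (simp add: bracket_def pullback_def msubst_sum)
  also have "\<dots> = bracket w"
    unfolding bracket_def using bij by (rule sum.reindex_bij_betw)
  finally show ?thesis .
qed

lemma phi_mvar: "phi (mvar w) = bracket w"
  by (simp add: phi_def msubst_mvar)

lemma phi_mconst: "phi (mconst c) = mconst c"
  by (simp add: phi_def msubst_mconst)

lemma phi_hom:
  "(phi :: ('m monom, 'k::field) mpoly \<Rightarrow> ('m \<times> 'n::finite, 'k) mpoly)
     \<in> ring_hom (Fq q) (invariant_ring (Gnq q))"
proof -
  have "pullback A (phi f) = (phi f :: ('m \<times> 'n, 'k) mpoly)"
    if f: "\<forall>a\<in>Poly_Mapping.keys f. Poly_Mapping.keys a \<subseteq> Mq q" and A: "A \<in> Gnq q" for f and A :: "'k^'n^'n"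
  proof -
    have "pullback A (phi f) = (\<Sum>a\<in>Poly_Mapping.keys f. mconst (Poly_Mapping.lookup f a) *
        (\<Prod>x\<in>Poly_Mapping.keys a. pullback A (bracket x :: ('m \<times> 'n, 'k) mpoly) ^ Poly_Mapping.lookup a x))"
      by (simp add: phi_def msubst_def[of bracket f] pullback_def msubst_sum msubst_mult
          msubst_mconst msubst_prod msubst_power)
    also have "\<dots> = phi f"
      unfolding phi_def msubst_def
      by (intro sum.cong prod.cong refl arg_cong2[of _ _ _ _ "(*)"])
        (use f in \<open>auto simp: Mq_def subset_iff intro!: pullback_bracket[OF A, THEN arg_cong]\<close>)
    finally show ?thesis .
  qed
  then show ?thesis
    by (auto simp: ring_hom_def Fq_def mpoly_ring_def invariant_ring_def ring_on_def
        phi_def[THEN fun_cong] msubst_add msubst_mult)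
qed

lemma Psi_in_Fq:
  assumes w: "\<And>i. i \<in> {1..N} \<Longrightarrow> w i \<in> Mq q"
  shows "Psi N w \<in> carrier (Fq q :: ('m monom, 'k::comm_ring_1) mpoly ring)"
proof -
  let ?C = "carrier (Fq q :: ('m monom, 'k) mpoly ring)"
  interpret cring "Fq q :: ('m monom, 'k) mpoly ring"
    unfolding Fq_def by (rule mpoly_ring_cring)
  have ops: "f \<oplus>\<^bsub>Fq q\<^esub> g = f + g" "f \<otimes>\<^bsub>Fq q\<^esub> g = f * g" "\<zero>\<^bsub>Fq q\<^esub> = 0" "\<one>\<^bsub>Fq q\<^esub> = 1"
    for f g :: "('m monom, 'k) mpoly"
    by (simp_all add: Fq_def mpoly_ring_def ring_on_def)
  have add: "f + g \<in> ?C" and mult: "f * g \<in> ?C" if "f \<in> ?C" "g \<in> ?C" for f g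
    using add.m_closed[OF that] m_closed[OF that] by (simp_all only: ops)
  have zero: "0 \<in> ?C" and one: "1 \<in> ?C"
    using zero_closed one_closed by (simp_all only: ops)
  have sum: "(\<Sum>a\<in>A. f a) \<in> ?C" if "\<And>a. a \<in> A \<Longrightarrow> f a \<in> ?C"
    for A :: "nat set set set" and f
    using that by (induction A rule: infinite_finite_induct) (auto intro: add zero)
  have prod: "(\<Prod>a\<in>A. f a) \<in> ?C" if "\<And>a. a \<in> A \<Longrightarrow> f a \<in> ?C"
    for A :: "nat set set" and f
    using that by (induction A rule: infinite_finite_induct) (auto intro: mult one)
  have of_nat: "of_nat n \<in> ?C" for n
    by (induction n) (auto intro: add zero one)
  have neg: "-1 \<in> ?C"
    by (auto simp: Fq_def mpoly_ring_def ring_on_def)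
  have pow: "(-1) ^ n \<in> ?C" for n
    by (induction n) (simp_all only: power_0 power_Suc one mult[OF neg])
  have sum_Mq: "(\<Sum>s\<in>B. w s) \<in> Mq q" if B: "B \<subseteq> {1..N}" "B \<noteq> {}" for B
  proof -
    have deg: "mdeg (a + b) = mdeg a + mdeg b" for a b :: "'m monom"
    proof -
      have ext: "mdeg c = (\<Sum>x\<in>Poly_Mapping.keys a \<union> Poly_Mapping.keys b. Poly_Mapping.lookup c x)" if "Poly_Mapping.keys c \<subseteq> Poly_Mapping.keys a \<union> Poly_Mapping.keys b" for c
        unfolding mdeg_def using that by (intro sum.mono_neutral_left) (auto simp: in_keys_iff)
      show ?thesis
        using Poly_Mapping.keys_add[of a b] by (simp add: ext lookup_add sum.distrib)
    qed
    have zero: "a = 0" if "a + b = 0" for a b :: "'m monom"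
      using that by (metis add_is_0 lookup_add lookup_zero poly_mapping_eqI)
    have "a + b \<in> Mq q" if "a \<in> Mq q" "b \<in> Mq q" for a b :: "'m monom"
      using that zero[of a b] by (auto simp: Mq_def deg)
    note add_Mq = this
    have "finite B" using B finite_subset by blast
    then show ?thesis
      using B(2,1) by (induction B rule: finite_ne_induct) (auto intro!: add_Mq w)
  qed
  have var: "mvar v \<in> ?C" if "v \<in> Mq q" for v
    using that by (auto simp: mvar_def Fq_def mpoly_ring_def ring_on_def)
  show ?thesis
    unfolding Psi_def
    by (intro sum mult pow prod of_nat var sum_Mq) (auto simp: partition_on_def)
qed

end

theory Submission
  imports Defs
begin

text \<open>Extend \<open>\<Psi>\<close> to families indexed by an arbitrary finite set \<open>S\<close>. Splitting off one index gives the
  recursion \<open>\<Psi>(w\<^sub>1,\<dots>,w\<^sub>k,v) = - t(v) \<Psi>(w\<^sub>1,\<dots>,w\<^sub>k) + \<Sum>\<^sub>i \<Psi>(w\<^sub>1,\<dots>,w\<^sub>iv,\<dots>,w\<^sub>k)\<close>, from which \<open>\<phi>\<close> maps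
  \<open>\<Psi>(w\<^sub>1,\<dots>,w\<^sub>k)\<close> to \<open>(-1)\<^sup>k\<close> times the sum of all products of the \<open>w\<^sub>i\<close> placed in distinct columns. This
  vanishes for \<open>k > n\<close>; for \<open>k = n\<close> it is, up to sign, a full \<open>S\<^sub>n\<close>-orbit sum, and sending the monomial
  with columns \<open>u\<^sub>1,\<dots>,u\<^sub>n\<close> to \<open>\<Psi>(u\<^sub>1,\<dots>,u\<^sub>n)\<close> inverts \<open>\<phi>\<close> on the span of these elements, up to the
  factor \<open>(-1)\<^sup>n n!\<close>. By the recursion, modulo the \<open>\<Psi>(w\<^sub>1,\<dots>,w\<^bsub>n+1\<^esub>)\<close> every element of \<open>\<F>(q)\<close> lies in
  that span, which yields the kernel. Invariance under diagonal matrices forces the columns of each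
  monomial of an invariant into \<open>\<M>(q) \<union> {1}\<close>, which yields surjectivity. A monomial of degree
  greater than \<open>nq\<close> is a product of \<open>n + 1\<close> elements of \<open>\<M>(q)\<close>, so their \<open>\<Psi>\<close> expresses its power sum by
  smaller ones; and as all relations have degree at least \<open>(n + 1)q\<close>, no generator of degree at most
  \<open>nq\<close> is redundant.\<close>


section \<open>The recursion for \<open>\<Psi>\<close>\<close>

text \<open>Two further index sets occur below: the columns themselves, and
  \<open>'n option\<close>, which has one element more than there are columns.\<close>

definition Psi_on :: "'i set \<Rightarrow> ('i \<Rightarrow> 'm monom) \<Rightarrow> ('m monom, 'k::comm_ring_1) mpoly" where
  "Psi_on S w = (\<Sum>P | partition_on S P.
     (-1) ^ card P * (\<Prod>B\<in>P. of_nat (fact (card B - 1)) * mvar (\<Sum>s\<in>B. w s)))"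

lemma Psi_eq_Psi_on: "Psi N w = Psi_on {1..N} w"
  by (simp add: Psi_def Psi_on_def)

text \<open>The block \<open>C\<close> containing \<open>a\<close> decides: if
  \<open>C = {a}\<close>, deleting it leaves a partition of \<open>S\<close>; otherwise
  \<open>C - {a}\<close> is a block \<open>B\<close> of a partition \<open>P\<close> of
  \<open>S\<close>, and the pair \<open>(P, B)\<close> records which block \<open>a\<close>
  joins.\<close>

lemma partition_on_insert_point:
  assumes "a \<notin> S"
  shows "{P. partition_on (insert a S) P} = insert {a} ` {P. partition_on S P} \<union>
    (\<lambda>(P, B). insert (insert a B) (P - {B})) ` (SIGMA P:{P. partition_on S P}. P)" (is "?L = ?R1 \<union> ?R2")
proof (intro equalityI subsetI)
  fix Q assume "Q \<in> ?L"
  then have Q: "partition_on (insert a S) Q" by simp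
  then obtain C where C: "C \<in> Q" "a \<in> C" by (auto simp: partition_on_def)
  have disj: "disjnt C (\<Union>(Q - {C}))"
    using partition_onD2[OF Q] C by (auto simp: disjoint_def disjnt_def)
  have Q': "Q = insert C (Q - {C})" using C by auto
  have P: "partition_on (insert a S - C) (Q - {C})" "C \<subseteq> insert a S"
    using partition_on_insert[OF disj] Q Q' by auto
  show "Q \<in> ?R1 \<union> ?R2"
  proof (cases "C = {a}")
    case True
    then have "Q = insert {a} (Q - {C})" "partition_on S (Q - {C})"
      using P assms Q' by auto
    then show ?thesis by blast
  next
    case False
    define B where "B = C - {a}"
    have B: "C = insert a B" "B \<noteq> {}" "a \<notin> B" using False C by (auto simp: B_def)
    have d: "disjnt B (\<Union>(Q - {C}))" using disj B by (auto simp: disjnt_def)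
    have "insert a S - C = S - B" using B assms by auto
    then have "partition_on S (insert B (Q - {C}))"
      using partition_on_insert[OF d, of S] P B assms by auto
    \<comment> \<open>A non-empty set disjoint from the other blocks is not one of them, so
      exchanging \<open>B\<close> for \<open>insert a B\<close> restores \<open>Q\<close>
      exactly.\<close>
    moreover have "B \<notin> Q - {C}" using d B by (auto simp: disjnt_def)
    then have "insert (insert a B) (insert B (Q - {C}) - {B}) = Q" using Q' B by auto
    ultimately show ?thesis by (force simp: image_iff)
  qed
next
  fix Q assume "Q \<in> ?R1 \<union> ?R2"
  then show "Q \<in> ?L"
  proof
    assume "Q \<in> ?R1"
    then obtain P where P: "Q = insert {a} P" "partition_on S P" by auto
    have "disjnt {a} (\<Union>P)" using partition_onD1[OF P(2)] assms by simp
    from partition_on_insert[OF this, of "insert a S"] show ?thesis using P assms by simp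
  next
    assume "Q \<in> ?R2"
    then obtain P B where P: "Q = insert (insert a B) (P - {B})" "partition_on S P" "B \<in> P" by auto
    have d: "disjnt B (\<Union>(P - {B}))"
      using partition_onD2[OF P(2)] P(3) by (auto simp: disjoint_def disjnt_def)
    have d': "disjnt (insert a B) (\<Union>(P - {B}))" 
      using d partition_onD1[OF P(2)] assms by (auto simp: disjnt_def)
    have "P = insert B (P - {B})" using P(3) by auto
    then have "partition_on (S - B) (P - {B})" "B \<subseteq> S" using partition_on_insert[OF d, of S] P(2) by auto
    moreover have "insert a S - insert a B = S - B" using assms by auto
    ultimately show ?thesis using partition_on_insert[OF d', of "insert a S"] P(1) by auto
  qed
qed

text \<open>Either \<open>a\<close> forms a block on its own, or it joins a block \<open>B\<close>; in the latter case
  \<open>(card B)! = (\<Sum>s\<in>B. (card B - 1)!)\<close> distributes the term over the elements of \<open>B\<close>.\<close>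

lemma Psi_on_insert:
  fixes w :: "'i \<Rightarrow> 'm monom"
  assumes "finite S" "a \<notin> S"
  shows "(Psi_on (insert a S) w :: ('m monom, 'k::comm_ring_1) mpoly)
    = - (mvar (w a) * Psi_on S w) + (\<Sum>s\<in>S. Psi_on S (w(s := w s + w a)))"
proof -
  define c :: "('i \<Rightarrow> 'm monom) \<Rightarrow> 'i set \<Rightarrow> ('m monom, 'k) mpoly"
    where "c w B = of_nat (fact (card B - 1)) * mvar (\<Sum>s\<in>B. w s)" for w B
  define T where "T w P = (-1) ^ card P * (\<Prod>B\<in>P. c w B)" for w P
  define \<P> where "\<P> = {P. partition_on S P}"
  define j where "j = (\<lambda>(P, B). insert (insert a B) (P - {B}))"
  have Psi: "Psi_on A v = (\<Sum>P | partition_on A P. T v P)" for A v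
    by (simp add: Psi_on_def T_def c_def)
  have part: "a \<notin> B" "finite B" "B \<noteq> {}" "B \<subseteq> S" if "P \<in> \<P>" "B \<in> P" for P B
    using that assms partition_onD1[of S P] partition_onD3[of S P] by (auto simp: \<P>_def intro: finite_subset)
  have fin: "finite P" if "P \<in> \<P>" for P
    using that finite_elements[OF assms(1)] by (auto simp: \<P>_def)
  have fin\<P>: "finite \<P>" unfolding \<P>_def using assms by (intro finitely_many_partition_on)
  have new: "{a} \<notin> P" "insert a C \<notin> P" if "P \<in> \<P>" for P C using part[OF that] by auto
  have inj1: "inj_on (insert {a}) \<P>"
    using new by (intro inj_onI) (metis insert_ident)
  \<comment> \<open>The only block of \<open>j (P, B)\<close> containing \<open>a\<close> is
    \<open>insert a B\<close>, which determines \<open>B\<close>; the remaining blocks then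
    determine \<open>P\<close>.\<close>
  have inj2: "inj_on j (SIGMA P:\<P>. P)"
  proof (rule inj_onI, clarify)
    fix P B P' B'
    assume P: "P \<in> \<P>" "B \<in> P" and P': "P' \<in> \<P>" "B' \<in> P'" and eq: "j (P, B) = j (P', B')"
    have "insert a B \<in> insert (insert a B') (P' - {B'})" using eq by (auto simp: j_def)
    then have "insert a B = insert a B'" using new[OF P'(1)] by auto
    then have BB: "B = B'" using part(1)[OF P] part(1)[OF P'] by (metis insert_ident)
    then have "insert (insert a B) (P - {B}) = insert (insert a B) (P' - {B})"
      using eq by (simp add: j_def)
    then have "P - {B} = P' - {B}"
      using insert_ident[of "insert a B" "P - {B}" "P' - {B'}"] new(2)[OF P(1)] new(2)[OF P'(1)] BB by simp
    then show "P = P' \<and> B = B'" using BB P P' by auto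
  qed
  have disj: "insert {a} ` \<P> \<inter> j ` (SIGMA P:\<P>. P) = {}"
  proof -
    have "insert {a} P \<noteq> j (P', B')" if P: "P \<in> \<P>" "P' \<in> \<P>" "B' \<in> P'" for P P' B'
    proof
      assume "insert {a} P = j (P', B')"
      then have "{a} \<in> insert (insert a B') (P' - {B'})" by (auto simp: j_def)
      then have "{a} = insert a B'" using new[OF P(2)] by auto
      then show False using part[OF P(2,3)] by auto
    qed
    then show ?thesis by auto
  qed
  have T1: "T w (insert {a} P) = - (mvar (w a) * T w P)" if "P \<in> \<P>" for P
    using fin[OF that] new[OF that] by (simp add: T_def c_def mult_ac)
  have T2: "T w (j (P, B)) = (\<Sum>s\<in>B. T (w(s := w s + w a)) P)" if PB: "P \<in> \<P>" "B \<in> P" for P B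
  proof -
    note B = part[OF PB] and P = fin[OF PB(1)]
    \<comment> \<open>Adding \<open>w a\<close> to one argument \<open>s\<close> of \<open>B\<close>
      changes only the factor of \<open>B\<close>, and in the same way for every
      \<open>s\<close>.\<close>
    have "T (w(s := w s + w a)) P = (-1) ^ card P * (of_nat (fact (card B - 1)) * mvar (sum w (insert a B)) * (\<Prod>B\<in>P-{B}. c w B))"
      if s: "s \<in> B" for s
    proof -
      have "c (w(s := w s + w a)) C = c w C" if "C \<in> P - {B}" for C
      proof -
        have "s \<notin> C" using that s PB partition_onD2[of S P] by (auto simp: \<P>_def disjoint_def)
        then have "sum (w(s := w s + w a)) C = sum w C" by (intro sum.cong) auto
        then show ?thesis by (simp only: c_def)
      qed
      moreover have "sum (w(s := w s + w a)) B = sum w (insert a B)"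
        using B s by (simp add: sum.remove[of B s] add_ac)
      ultimately show ?thesis
        using prod.remove[OF P PB(2), of "c (w(s := w s + w a))"] by (simp add: T_def c_def[of _ B])
    qed
    then have "(\<Sum>s\<in>B. T (w(s := w s + w a)) P)
      = of_nat (card B) * ((-1) ^ card P * (of_nat (fact (card B - 1)) * mvar (sum w (insert a B)) * (\<Prod>B\<in>P-{B}. c w B)))"
      by simp
    also have "\<dots> = (-1) ^ card P * (of_nat (card B * fact (card B - 1)) * mvar (sum w (insert a B)) * (\<Prod>B\<in>P-{B}. c w B))"
      by (simp add: mult_ac)
    also have "card B * fact (card B - 1) = fact (card B)"
      using B by (metis card_gt_0_iff fact_reduce of_nat_id)
    also have "(-1) ^ card P * (of_nat (fact (card B)) * mvar (sum w (insert a B)) * (\<Prod>B\<in>P-{B}. c w B))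
        = T w (j (P, B))"
    proof -
      have "card (insert (insert a B) (P - {B})) = card P"
        using P new(2)[OF PB(1)] card.remove[OF P PB(2)] by simp
      then show ?thesis
        using P B new[OF PB(1)] by (simp add: T_def j_def c_def mult_ac)
    qed
    finally show ?thesis ..
  qed
  have "Psi_on (insert a S) w = (\<Sum>P\<in>insert {a} ` \<P> \<union> j ` (SIGMA P:\<P>. P). T w P)"
    unfolding Psi partition_on_insert_point[OF assms(2)] \<P>_def j_def ..
  also have "\<dots> = (\<Sum>P\<in>insert {a} ` \<P>. T w P) + (\<Sum>P\<in>j ` (SIGMA P:\<P>. P). T w P)"
    using fin\<P> fin disj by (intro sum.union_disjoint) auto
  also have "(\<Sum>P\<in>insert {a} ` \<P>. T w P) = - (mvar (w a) * Psi_on S w)"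
    by (simp add: sum.reindex[OF inj1] T1 sum_negf sum_distrib_left Psi \<P>_def[symmetric])
  also have "(\<Sum>P\<in>j ` (SIGMA P:\<P>. P). T w P) = (\<Sum>P\<in>\<P>. \<Sum>B\<in>P. T w (j (P, B)))"
    using fin\<P> fin by (simp add: sum.reindex[OF inj2] sum.Sigma)
  also have "\<dots> = (\<Sum>P\<in>\<P>. \<Sum>B\<in>P. \<Sum>s\<in>B. T (w(s := w s + w a)) P)"
    by (simp add: T2)
  also have "\<dots> = (\<Sum>P\<in>\<P>. \<Sum>s\<in>S. T (w(s := w s + w a)) P)"
  proof (intro sum.cong refl)
    fix P assume P: "P \<in> \<P>"
    then have "S = \<Union>P" "disjoint P" by (auto simp: \<P>_def partition_on_def)
    then show "(\<Sum>B\<in>P. \<Sum>s\<in>B. T (w(s := w s + w a)) P) = (\<Sum>s\<in>S. T (w(s := w s + w a)) P)"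
      using part(2)[OF P] by (subst \<open>S = \<Union>P\<close>, subst sum.Union_disjoint) (auto simp: disjoint_def)
  qed
  also have "\<dots> = (\<Sum>s\<in>S. Psi_on S (w(s := w s + w a)))"
    unfolding Psi \<P>_def by (rule sum.swap)
  finally show ?thesis .
qed

lemma Psi_on_empty [simp]: "Psi_on {} w = 1"
  by (simp add: Psi_on_def partition_on_empty)

lemma Psi_on_cong: "(\<And>s. s \<in> S \<Longrightarrow> w s = v s) \<Longrightarrow> Psi_on S w = Psi_on S v"
  unfolding Psi_on_def partition_on_def
  by (intro sum.cong prod.cong refl arg_cong2[of _ _ _ _ "(*)"] arg_cong[where f = mvar]) auto

text \<open>Both sides satisfy the recursion, so induction on \<open>S\<close> replaces a transport
  of set partitions along \<open>p\<close>. In particular, permuting the arguments leaves the value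
  unchanged.\<close>

lemma Psi_on_image:
  assumes "finite S" "inj_on p S"
  shows "Psi_on (p ` S) w = (Psi_on S (w \<circ> p) :: ('m monom, 'k::comm_ring_1) mpoly)"
  using assms
proof (induction S arbitrary: w rule: finite_induct)
  case (insert a S)
  then have inj: "inj_on p S" and a: "p a \<notin> p ` S" by auto
  have upd: "Psi_on (p ` S) (w(p s := w (p s) + w (p a))) = (Psi_on S ((w \<circ> p)(s := w (p s) + w (p a))) :: ('m monom, 'k) mpoly)"
    if "s \<in> S" for s
    unfolding insert.IH[OF inj] using that inj by (intro Psi_on_cong) (simp add: inj_on_eq_iff)
  then show ?case
    using insert(1,2) a by (simp add: Psi_on_insert sum.reindex[OF inj] insert.IH[OF inj, of w] upd comp_def)
qed simp

section \<open>The image of \<open>Psi\<close> under \<open>phi\<close>\<close>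

lemma prod_fun_upd_mult:
  "finite S \<Longrightarrow> s \<in> S \<Longrightarrow> (\<Prod>i\<in>S. g i ((w(s := x)) i)) = g s x * (\<Prod>i\<in>S - {s}. g i (w i))"
  by (subst prod.remove[of S s]) (auto intro!: prod.cong arg_cong2[where f = "(*)"])

lemma at_index_add: "at_index (v + w) j = at_index v j * at_index w j"
  unfolding at_index_def by (rule mpow_add)

lemma at_index_0 [simp]: "at_index 0 j = 1"
  by (simp add: at_index_def)

lemma msubst_diff: "msubst \<sigma> (f - g) = msubst \<sigma> f - msubst \<sigma> g"
  using msubst_add[of \<sigma> f "- g"] by (simp add: msubst_uminus)

lemma phi_simps:
  "phi (f - g) = phi f - phi g" "phi (f + g) = phi f + phi g" "phi (f * g) = phi f * phi g" "phi (- f) = - phi f"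
  "phi (sum h A) = (\<Sum>x\<in>A. phi (h x))" "phi 0 = 0" "phi 1 = 1"
  by (simp_all add: phi_def msubst_add msubst_mult msubst_uminus msubst_diff msubst_sum)

text \<open>Both sides satisfy the same recursion. Multiplication by \<open>bracket (w a)\<close>
  puts \<open>w a\<close> into every column. If that column already holds \<open>w s\<close>, the
  result is a placement with \<open>w s\<close> replaced by \<open>w s + w a\<close>; subtracting
  these leaves the placements in distinct columns.\<close>

lemma phi_Psi_on:
  fixes w :: "'i \<Rightarrow> 'm monom"
  assumes "finite S"
  shows "phi (Psi_on S w) = (-1) ^ card S *
    (\<Sum>f | f \<in> S \<rightarrow>\<^sub>E UNIV \<and> inj_on f S. \<Prod>s\<in>S. at_index (w s) (f s) :: ('m \<times> 'n::finite, 'k::comm_ring_1) mpoly)"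
  using assms
proof (induction S arbitrary: w rule: finite_induct)
  case empty
  then show ?case by (simp add: phi_simps PiE_empty_domain)
next
  case (insert a S)
  define I where "I A = {f. f \<in> A \<rightarrow>\<^sub>E (UNIV :: 'n set) \<and> inj_on f A}" for A :: "'i set"
  define Q where "Q w f = (\<Prod>s\<in>S. at_index (w s) (f s) :: ('m \<times> 'n, 'k) mpoly)" for w and f :: "'i \<Rightarrow> 'n"
  have finI: "finite (I S)" unfolding I_def using insert(1)
    by (rule finite_subset[rotated, OF finite_PiE]) auto
  \<comment> \<open>An injective placement of \<open>insert a S\<close> is one of \<open>S\<close>
    together with a free column for \<open>a\<close>. Restriction resets the value at
    \<open>a\<close> to \<open>undefined\<close>, as extensional functions on \<open>S\<close>
    require.\<close>
  have bij: "bij_betw (\<lambda>(f, j). f(a := j)) (SIGMA f:I S. - f ` S) (I (insert a S))"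
  proof (rule bij_betw_byWitness[where f' = "\<lambda>f. (f(a := undefined), f a)"])
    show "\<forall>x\<in>SIGMA f:I S. - f ` S. (\<lambda>f. (f(a := undefined), f a)) ((\<lambda>(f, j). f(a := j)) x) = x"
      using insert(2) by (auto simp: I_def PiE_def extensional_def)
    show "\<forall>f\<in>I (insert a S). (\<lambda>(f, j). f(a := j)) ((\<lambda>f. (f(a := undefined), f a)) f) = f" by auto
    show "(\<lambda>(f, j). f(a := j)) ` (SIGMA f:I S. - f ` S) \<subseteq> I (insert a S)"
    proof clarify
      fix f j assume f: "f \<in> I S" "j \<notin> f ` S"
      have "(f(a := j)) ` S = f ` S" "inj_on (f(a := j)) S"
        using insert(2) f by (auto simp: I_def intro!: inj_on_fun_updI)
      then have "inj_on (f(a := j)) (insert a S)"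
        using insert(2) f by simp
      then show "f(a := j) \<in> I (insert a S)"
        using f by (auto simp: I_def PiE_def extensional_def)
    qed
    show "(\<lambda>f. (f(a := undefined), f a)) ` I (insert a S) \<subseteq> (SIGMA f:I S. - f ` S)"
    proof clarify
      fix f assume f: "f \<in> I (insert a S)"
      have eq: "(f(a := undefined)) s = f s" if "s \<in> S" for s
        using that insert(2) by auto
      have "inj_on f S" "f a \<notin> f ` S"
        using f insert(2) by (simp_all add: I_def)
      moreover have "inj_on (f(a := undefined)) S \<longleftrightarrow> inj_on f S" "(f(a := undefined)) ` S = f ` S"
        using eq by (simp_all cong: inj_on_cong image_cong)
      moreover have "f(a := undefined) \<in> S \<rightarrow>\<^sub>E UNIV"
        using f by (auto simp: I_def PiE_def extensional_def)
      ultimately show "f(a := undefined) \<in> I S \<and> f a \<in> - (f(a := undefined)) ` S"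
        by (simp add: I_def)
    qed
  qed
  have Qa: "(\<Prod>s\<in>insert a S. at_index (w s) ((f(a := j)) s)) = at_index (w a) j * Q w f" for f j
    using insert(1,2) by (auto simp: Q_def intro!: arg_cong2[where f = "(*)"] prod.cong)
  have Qs: "Q (w(s := w s + w a)) f = at_index (w a) (f s) * Q w f" if "s \<in> S" for s f
    using insert(1) that prod_fun_upd_mult[of S s "\<lambda>i v. at_index v (f i)" w "w s + w a"]
    by (simp add: Q_def at_index_add prod.remove[of S s] mult_ac)
  have "(\<Sum>f\<in>I (insert a S). \<Prod>s\<in>insert a S. at_index (w s) (f s)) 
      = (\<Sum>f\<in>I S. \<Sum>j\<in>- f ` S. at_index (w a) j * Q w f)"
    using finI Qa by (subst sum.reindex_bij_betw[OF bij, symmetric]) (simp add: sum.Sigma split_def)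
  also have "\<dots> = (\<Sum>f\<in>I S. bracket (w a) * Q w f - (\<Sum>s\<in>S. Q (w(s := w s + w a)) f))"
  proof (intro sum.cong refl)
    fix f assume f: "f \<in> I S"
    have "bracket (w a) * Q w f = (\<Sum>j\<in>UNIV. at_index (w a) j * Q w f)"
      by (simp add: bracket_def sum_distrib_right)
    also have "\<dots> = (\<Sum>j\<in>- f ` S. at_index (w a) j * Q w f) + (\<Sum>j\<in>f ` S. at_index (w a) j * Q w f)"
      by (subst sum.subset_diff[of "f ` S"]) (auto simp: Compl_eq_Diff_UNIV)
    also have "(\<Sum>j\<in>f ` S. at_index (w a) j * Q w f) = (\<Sum>s\<in>S. Q (w(s := w s + w a)) f)"
      using f by (subst sum.reindex) (auto simp: I_def Qs)
    finally show "(\<Sum>j\<in>- f ` S. at_index (w a) j * Q w f)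
        = bracket (w a) * Q w f - (\<Sum>s\<in>S. Q (w(s := w s + w a)) f)" by simp
  qed
  also have "\<dots> = bracket (w a) * (\<Sum>f\<in>I S. Q w f) - (\<Sum>s\<in>S. \<Sum>f\<in>I S. Q (w(s := w s + w a)) f)"
    by (simp add: sum_subtractf sum_distrib_left) (rule sum.swap)
  finally have *: "(\<Sum>f\<in>I (insert a S). \<Prod>s\<in>insert a S. at_index (w s) (f s)) =
    bracket (w a) * (\<Sum>f\<in>I S. Q w f) - (\<Sum>s\<in>S. \<Sum>f\<in>I S. Q (w(s := w s + w a)) f)" .
  have "phi (Psi_on (insert a S) w) = - (bracket (w a) * ((-1) ^ card S * (\<Sum>f\<in>I S. Q w f)))
      + (\<Sum>s\<in>S. (-1) ^ card S * (\<Sum>f\<in>I S. Q (w(s := w s + w a)) f))"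
    using insert(1,2) insert.IH by (simp add: Psi_on_insert phi_simps phi_mvar Q_def I_def)
  also have "\<dots> = (-1) ^ card (insert a S) * (bracket (w a) * (\<Sum>f\<in>I S. Q w f) - (\<Sum>s\<in>S. \<Sum>f\<in>I S. Q (w(s := w s + w a)) f))"
    using insert(1,2) by (simp add: right_diff_distrib mult.left_commute flip: sum_distrib_left)
  finally show ?case unfolding I_def[symmetric] * .
qed

section \<open>Linear algebra of polynomials\<close>

lemma mconst_of_nat: "mconst (of_nat n :: 'k::comm_ring_1) = of_nat n"
  by (induction n) simp_all

lemma mconst_uminus: "mconst (- c :: 'k::comm_ring_1) = - mconst c"
  using mconst_simps(3)[of c "- c"] by (simp add: eq_neg_iff_add_eq_0 add.commute)

lemma mconst_diff: "mconst (c - d :: 'k::comm_ring_1) = mconst c - mconst d"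
  using mconst_simps(3)[of c "- d"] by (simp add: mconst_uminus)

lemma mconst_neg_one_power: "mconst ((-1) ^ n :: 'k::comm_ring_1) = (-1) ^ n"
  by (simp add: mconst_power mconst_uminus)

lemma lookup_mconst_mult: "Poly_Mapping.lookup (mconst c * f) a = c * Poly_Mapping.lookup f a"
  for c :: "'k::comm_ring_1"
proof -
  have "Poly_Mapping.lookup (mconst c * f) a = (c * Poly_Mapping.lookup f a when Poly_Mapping.lookup f a \<noteq> 0)"
    unfolding mconst_def mult_map_scale_conv_mult[symmetric] by (simp add: Poly_Mapping.map.rep_eq)
  then show ?thesis by (cases "Poly_Mapping.lookup f a = 0") auto
qed

text \<open>Provides linear spans and induction over them, with scalars acting through
  \<open>mconst\<close>.\<close>

lemma module_mpoly: "Modules.module (\<lambda>(c::'k::comm_ring_1) (f::('x, 'k) mpoly). mconst c * f)"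
  by standard (simp_all add: algebra_simps)

lemma msubst_msubst: "msubst \<sigma> (msubst \<tau> f) = msubst (\<lambda>x. msubst \<sigma> (\<tau> x)) f"
  by (simp add: msubst_def[of _ f] msubst_sum msubst_mult msubst_mconst msubst_prod msubst_power)

lemma msubst_cong:
  "(\<And>a x. a \<in> Poly_Mapping.keys f \<Longrightarrow> x \<in> Poly_Mapping.keys a \<Longrightarrow> \<sigma> x = \<tau> x) \<Longrightarrow> msubst \<sigma> f = msubst \<tau> f"
  unfolding msubst_def by (intro sum.cong prod.cong arg_cong2[where f = "(*)"]) auto

lemma mvar_power: "mvar x ^ k = Poly_Mapping.single (Poly_Mapping.single x k) (1 :: 'k::comm_ring_1)"
  by (induction k) (simp_all add: mvar_def mult_single single_add[symmetric])

lemma prod_single_1: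
  "(\<Prod>i\<in>A. Poly_Mapping.single (g i) (1 :: 'k::comm_ring_1)) = Poly_Mapping.single (\<Sum>i\<in>A. g i) 1"
  by (induction A rule: infinite_finite_induct) (simp_all add: mult_single)

lemma prod_mvar_power: "(\<Prod>x\<in>Poly_Mapping.keys a. mvar x ^ Poly_Mapping.lookup a x)
    = Poly_Mapping.single a (1 :: 'k::comm_ring_1)"
  by (simp add: mvar_power prod_single_1 sum_monomials)

lemma single_eq_mconst_mult: "Poly_Mapping.single a c = mconst c * Poly_Mapping.single a (1 :: 'k::comm_ring_1)"
  by (simp add: mconst_def mult_single)

lemma msubst_mvar_id: "msubst mvar f = f"
  unfolding msubst_def prod_mvar_power by (simp add: sum_monomials flip: single_eq_mconst_mult)

text \<open>\<open>phi\<close> identifies \<open>t(1)\<close> with the number of columns; the substitution \<open>elim_t1\<close> removes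
  this extra variable, so that arguments \<open>w s = 0\<close> become admissible in \<open>Psi_on\<close>.\<close>

definition elim_t1 :: "nat \<Rightarrow> ('m monom, 'k::comm_ring_1) mpoly \<Rightarrow> ('m monom, 'k) mpoly" where
  "elim_t1 n = msubst (\<lambda>w. if w = 0 then of_nat n else mvar w)"

lemma elim_t1_simps:
  "elim_t1 n (f + g) = elim_t1 n f + elim_t1 n g"
  "elim_t1 n (f - g) = elim_t1 n f - elim_t1 n g"
  "elim_t1 n (- f) = - elim_t1 n f"
  "elim_t1 n (f * g) = elim_t1 n f * elim_t1 n g"
  "elim_t1 n (sum h A) = (\<Sum>x\<in>A. elim_t1 n (h x))"
  "elim_t1 n 1 = 1"
  "elim_t1 n (of_nat k) = of_nat k"
  "elim_t1 n (mvar w) = (if w = 0 then of_nat n else mvar w)"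
  by (simp_all add: elim_t1_def msubst_add msubst_mult msubst_uminus msubst_diff msubst_sum msubst_mvar
      msubst_mconst flip: mconst_of_nat)

lemma bracket_0: "bracket 0 = (of_nat CARD('n) :: ('m \<times> 'n::finite, 'k::comm_ring_1) mpoly)"
  by (simp add: bracket_def)

lemma phi_elim_t1: "phi (elim_t1 CARD('n) f) = (phi f :: ('m \<times> 'n::finite, 'k::comm_ring_1) mpoly)"
proof -
  have "msubst bracket (if w = 0 then of_nat CARD('n) else mvar w) = (bracket w :: ('m \<times> 'n, 'k) mpoly)" for w
    by (simp add: msubst_mvar msubst_mconst bracket_0 flip: mconst_of_nat)
  then show ?thesis
    by (simp add: phi_def elim_t1_def msubst_msubst)
qed

section \<open>Membership in \<open>Fq q\<close> and degrees of monomials\<close>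

lemma carrier_Fq: "carrier (Fq q) = {f. \<forall>a\<in>Poly_Mapping.keys f. Poly_Mapping.keys a \<subseteq> Mq q}"
  by (simp add: Fq_def mpoly_ring_def ring_on_def)

lemma ring_on_simps [simp]:
  "carrier (ring_on C) = C" "f \<oplus>\<^bsub>ring_on C\<^esub> g = f + g" "f \<otimes>\<^bsub>ring_on C\<^esub> g = f * g"
  "\<zero>\<^bsub>ring_on C\<^esub> = 0" "\<one>\<^bsub>ring_on C\<^esub> = 1"
  by (simp_all add: ring_on_def)

lemma Fq_ops:
  "f \<oplus>\<^bsub>Fq q\<^esub> g = f + g" "f \<otimes>\<^bsub>Fq q\<^esub> g = f * g" "\<zero>\<^bsub>Fq q\<^esub> = 0" "\<one>\<^bsub>Fq q\<^esub> = 1"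
  by (simp_all add: Fq_def mpoly_ring_def)

lemma Fq_cring: "cring (Fq q :: ('m monom, 'k::comm_ring_1) mpoly ring)"
  unfolding Fq_def by (rule mpoly_ring_cring)

lemma elim_t1_id: "f \<in> carrier (Fq q) \<Longrightarrow> elim_t1 n f = f"
  unfolding elim_t1_def carrier_Fq
  by (rule trans[OF msubst_cong msubst_mvar_id]) (auto simp: Mq_def)

lemma
  fixes f g :: "('m monom, 'k::comm_ring_1) mpoly"
  shows Fq_add: "f \<in> carrier (Fq q) \<Longrightarrow> g \<in> carrier (Fq q) \<Longrightarrow> f + g \<in> carrier (Fq q)"
    and Fq_mult: "f \<in> carrier (Fq q) \<Longrightarrow> g \<in> carrier (Fq q) \<Longrightarrow> f * g \<in> carrier (Fq q)"
    and Fq_uminus: "f \<in> carrier (Fq q) \<Longrightarrow> - f \<in> carrier (Fq q)"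
    and Fq_mconst: "mconst c \<in> carrier (Fq q :: ('m monom, 'k) mpoly ring)"
    and Fq_mvar: "w \<in> Mq q \<Longrightarrow> mvar w \<in> carrier (Fq q :: ('m monom, 'k) mpoly ring)"
proof -
  interpret cring "Fq q :: ('m monom, 'k) mpoly ring" by (rule Fq_cring)
  show "f \<in> carrier (Fq q) \<Longrightarrow> g \<in> carrier (Fq q) \<Longrightarrow> f + g \<in> carrier (Fq q)"
    "f \<in> carrier (Fq q) \<Longrightarrow> g \<in> carrier (Fq q) \<Longrightarrow> f * g \<in> carrier (Fq q)"
    using add.m_closed[of f g] m_closed[of f g] by (simp_all only: Fq_ops)
qed (auto simp: carrier_Fq mconst_def mvar_def)

lemma Fq_of_nat: "of_nat k \<in> carrier (Fq q :: ('m monom, 'k::comm_ring_1) mpoly ring)"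
  using Fq_mconst[of "of_nat k"] by (simp add: mconst_of_nat)

lemma Fq_sum: "(\<And>x. x \<in> A \<Longrightarrow> h x \<in> carrier (Fq q)) \<Longrightarrow> sum h A \<in> carrier (Fq q :: ('m monom, 'k::comm_ring_1) mpoly ring)"
  by (induction A rule: infinite_finite_induct) (auto intro: Fq_add simp: Fq_mconst[of 0, simplified])

lemma mdeg_superset:
  "finite U \<Longrightarrow> Poly_Mapping.keys c \<subseteq> U \<Longrightarrow> mdeg c = (\<Sum>x\<in>U. Poly_Mapping.lookup c x)"
  unfolding mdeg_def by (intro sum.mono_neutral_left) (auto simp: in_keys_iff)

lemma mdeg_add: "mdeg (a + b) = mdeg a + mdeg b"
  using Poly_Mapping.keys_add[of a b]
  by (simp add: mdeg_superset[of "Poly_Mapping.keys a \<union> Poly_Mapping.keys b"] lookup_add sum.distrib)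

lemma mdeg_0 [simp]: "mdeg 0 = 0"
  by (simp add: mdeg_def)

lemma mdeg_sum: "mdeg (sum w A) = (\<Sum>s\<in>A. mdeg (w s))"
  by (induction A rule: infinite_finite_induct) (simp_all add: mdeg_add)

lemma mdeg_eq_0_iff: "mdeg a = 0 \<longleftrightarrow> a = 0"
proof
  assume "mdeg a = 0"
  then have "Poly_Mapping.lookup a x = Poly_Mapping.lookup 0 x" for x by (auto simp: mdeg_def in_keys_iff)
  then show "a = 0" by (rule poly_mapping_eqI)
qed simp

lemma Mq_iff: "w \<in> Mq q \<longleftrightarrow> mdeg w \<noteq> 0 \<and> q dvd mdeg w"
  by (simp add: Mq_def mdeg_eq_0_iff)

lemma Mq_sum:
  assumes "finite B" "B \<noteq> {}" "\<And>s. s \<in> B \<Longrightarrow> w s \<in> Mq q"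
  shows "sum w B \<in> Mq q"
  using assms by (auto simp: Mq_iff mdeg_sum intro!: dvd_sum)

section \<open>\<open>Psi\<close> with some arguments equal to the monomial 1\<close>

lemma elim_t1_Psi_on_in_Fq:
  assumes "finite S" "\<And>s. s \<in> S \<Longrightarrow> q dvd mdeg (w s)"
  shows "elim_t1 n (Psi_on S w) \<in> carrier (Fq q :: ('m monom, 'k::comm_ring_1) mpoly ring)"
  using assms
proof (induction S arbitrary: w rule: finite_induct)
  case empty
  show ?case using Fq_mconst[of 1] by (simp add: elim_t1_simps)
next
  case (insert a S)
  have "(if w a = 0 then of_nat n else mvar (w a)) \<in> carrier (Fq q :: ('m monom, 'k) mpoly ring)"
    using insert.prems[of a] Fq_mvar[of "w a" q] Fq_mconst[of "of_nat n" q] by (auto simp: Mq_def mconst_of_nat)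
  moreover have "elim_t1 n (Psi_on S (w(s := w s + w a))) \<in> carrier (Fq q :: ('m monom, 'k) mpoly ring)" if "s \<in> S" for s
    using that insert.prems by (intro insert.IH) (auto simp: mdeg_add)
  ultimately show ?case
    using insert by (auto simp: Psi_on_insert elim_t1_simps(1,3-5,8) simp del: if_split add_uminus_conv_diff uminus_add_conv_diff intro!: Fq_add Fq_uminus Fq_mult Fq_sum Fq_of_nat)
qed

text \<open>Merging the monomial 1 into another argument changes nothing, so the recursion gives
  \<open>card S\<close> equal summands, while \<open>t(1)\<close> contributes the factor
  \<open>- n\<close>. For \<open>card S = n\<close> the two cancel.\<close>

lemma elim_t1_Psi_on_insert_0:
  fixes w :: "'i \<Rightarrow> 'm monom"
  assumes "finite S" "a \<notin> S" "w a = 0"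
  shows "elim_t1 n (Psi_on (insert a S) w) = (of_nat (card S) - of_nat n) * (elim_t1 n (Psi_on S w) :: ('m monom, 'k::comm_ring_1) mpoly)"
  using assms by (simp add: Psi_on_insert elim_t1_simps fun_upd_idem left_diff_distrib)

text \<open>Trivial arguments are removed one at a time. For \<open>card S = n\<close> the product
  is \<open>(-1)^n n!\<close>.\<close>

lemma elim_t1_Psi_on_0:
  assumes "finite S"
  shows "elim_t1 n (Psi_on S (\<lambda>_. 0) :: ('m monom, 'k::comm_ring_1) mpoly) = mconst (\<Prod>k<card S. of_nat k - of_nat n)"
  using assms
proof (induction S rule: finite_induct)
  case (insert a S)
  then show ?case 
    by (simp add: elim_t1_Psi_on_insert_0 mconst_of_nat mconst_diff mult.commute)
qed (simp add: elim_t1_simps)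

text \<open>By the pigeonhole principle there is no placement in distinct columns, so the sum in
  \<open>phi_Psi_on\<close> is empty.\<close>

lemma phi_Psi_on_eq_0:
  assumes "finite S" "card S > CARD('n)"
  shows "phi (Psi_on S w) = (0 :: ('m \<times> 'n::finite, 'k::comm_ring_1) mpoly)"
proof -
  have "{f. f \<in> S \<rightarrow>\<^sub>E (UNIV :: 'n set) \<and> inj_on f S} = {}"
    using assms card_inj_on_le[of _ S "UNIV :: 'n set"] by fastforce
  then show ?thesis by (simp only: phi_Psi_on[OF assms(1)] sum.empty mult_zero_right)
qed

section \<open>Columns of monomials and the linear lift along \<open>phi\<close>\<close>

definition column_monom :: "('m \<times> 'n) monom \<Rightarrow> 'n \<Rightarrow> 'm monom" where
  "column_monom a j = Poly_Mapping.map_key (\<lambda>i. (i, j)) a"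

lemma lookup_column: "Poly_Mapping.lookup (column_monom a j) i = Poly_Mapping.lookup a (i, j)"
  unfolding column_monom_def by (subst map_key.rep_eq) (auto intro: injI)

text \<open>The inverse of \<open>column_monom\<close>: monomials of \<open>K[V^m]\<close>
  correspond to families of \<open>n\<close> monomials in the \<open>x(i)\<close>, one for each
  column.\<close>

definition join_columns :: "('n::finite \<Rightarrow> 'm monom) \<Rightarrow> ('m \<times> 'n) monom" where
  "join_columns v = (\<Sum>j\<in>UNIV. \<Sum>i\<in>Poly_Mapping.keys (v j). Poly_Mapping.single (i, j) (Poly_Mapping.lookup (v j) i))"

lemma prod_at_index: "(\<Prod>j\<in>UNIV. at_index (v j) j) = Poly_Mapping.single (join_columns v) (1 :: 'k::comm_ring_1)"
  by (simp add: at_index_def mvar_power prod_single_1 join_columns_def)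

lemma lookup_join_columns: "Poly_Mapping.lookup (join_columns v) (i, j) = Poly_Mapping.lookup (v j) i"
proof -
  have "Poly_Mapping.lookup (\<Sum>i'\<in>Poly_Mapping.keys (v j'). Poly_Mapping.single (i', j') (Poly_Mapping.lookup (v j') i')) (i, j)
      = (if j' = j then Poly_Mapping.lookup (v j) i else 0)" for j'
    by (auto simp: lookup_sum lookup_single when_def in_keys_iff)
  then show ?thesis by (simp add: join_columns_def lookup_sum)
qed

lemma column_join_columns [simp]: "column_monom (join_columns v) = v"
  by (intro ext poly_mapping_eqI) (simp add: lookup_column lookup_join_columns)

lemma join_columns_column [simp]: "join_columns (column_monom a) = a"
  by (intro poly_mapping_eqI) (auto simp: lookup_column lookup_join_columns)

text \<open>In contrast to \<open>msubst\<close> the extension is only linear: the lift built from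
  it is not multiplicative in general.\<close>

definition linear_ext :: "('x monom \<Rightarrow> ('y, 'k) mpoly) \<Rightarrow> ('x, 'k::comm_ring_1) mpoly \<Rightarrow> ('y, 'k) mpoly" where
  "linear_ext G f = (\<Sum>a\<in>Poly_Mapping.keys f. mconst (Poly_Mapping.lookup f a) * G a)"

lemma linear_ext_superset:
  assumes "finite U" "Poly_Mapping.keys f \<subseteq> U"
  shows "linear_ext G f = (\<Sum>a\<in>U. mconst (Poly_Mapping.lookup f a) * G a)"
  unfolding linear_ext_def using assms by (intro sum.mono_neutral_left) (auto simp: in_keys_iff)

lemma linear_ext_add: "linear_ext G (f + g) = linear_ext G f + linear_ext G g"
  using Poly_Mapping.keys_add[of f g]
  by (simp add: linear_ext_superset[of "Poly_Mapping.keys f \<union> Poly_Mapping.keys g"] lookup_add sum.distrib distrib_right)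

lemma linear_ext_0 [simp]: "linear_ext G 0 = 0"
  by (simp add: linear_ext_def)

lemma linear_ext_sum: "linear_ext G (sum h A) = (\<Sum>x\<in>A. linear_ext G (h x))"
  by (induction A rule: infinite_finite_induct) (simp_all add: linear_ext_add)

lemma linear_ext_single: "linear_ext G (Poly_Mapping.single a c) = mconst c * G a"
  by (simp add: linear_ext_def)

lemma linear_ext_mconst_mult: "linear_ext G (mconst c * f) = mconst c * linear_ext G f"
proof -
  have "Poly_Mapping.keys (mconst c * f) \<subseteq> Poly_Mapping.keys f"
    by (auto simp: in_keys_iff lookup_mconst_mult)
  then show ?thesis
    by (subst linear_ext_superset[of "Poly_Mapping.keys f"])
      (simp_all add: linear_ext_def lookup_mconst_mult sum_distrib_left mult.assoc)
qed

text \<open>Up to the factor \<open>(-1)\<^sup>n n!\<close>, \<open>symmetrized_lift\<close> is a linear section of \<open>phi\<close> on the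
  invariants.\<close>

definition symmetrized_lift :: "('m \<times> 'n::finite, 'k::comm_ring_1) mpoly \<Rightarrow> ('m monom, 'k) mpoly" where
  "symmetrized_lift = linear_ext (\<lambda>a. elim_t1 CARD('n) (Psi_on UNIV (column_monom a)))"

lemma card_inj_UNIV: "card {f :: 'n::finite \<Rightarrow> 'n. f \<in> UNIV \<rightarrow>\<^sub>E UNIV \<and> inj_on f UNIV} = fact CARD('n)"
  using card_inj_on_subset_funcset[of "UNIV :: 'n set" "UNIV :: 'n set" UNIV]
  by (simp add: fact_prod_rev)

lemma prod_at_index_bij:
  fixes p :: "'n::finite \<Rightarrow> 'n"
  assumes "bij p"
  shows "(\<Prod>s\<in>UNIV. at_index (u s) (p s)) = Poly_Mapping.single (join_columns (u \<circ> inv_into UNIV p)) (1 :: 'k::comm_ring_1)"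
proof -
  have "(\<Prod>s\<in>UNIV. at_index (u s) (p s)) = (\<Prod>j\<in>UNIV. at_index ((u \<circ> inv_into UNIV p) j) j :: (_, 'k) mpoly)"
    using prod.reindex_bij_betw[OF assms, of "\<lambda>j. at_index ((u \<circ> inv_into UNIV p) j) j :: (_, 'k) mpoly"] assms
    by (simp add: bij_is_inj)
  then show ?thesis by (simp only: prod_at_index)
qed

text \<open>\<open>phi\<close> yields \<open>(-1)^n\<close> times a sum over the \<open>n!\<close>
  permutations of the columns. The lift of each summand is \<open>Psi\<close> of the permuted
  arguments, which is always the same element.\<close>

lemma symmetrized_lift_phi:
  fixes u :: "'n::finite \<Rightarrow> 'm monom"
  shows "symmetrized_lift (phi (elim_t1 CARD('n) (Psi_on UNIV u)) :: ('m \<times> 'n, 'k::comm_ring_1) mpoly)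
    = mconst ((-1) ^ CARD('n) * of_nat (fact CARD('n))) * elim_t1 CARD('n) (Psi_on UNIV u)"
proof -
  let ?I = "{f :: 'n \<Rightarrow> 'n. f \<in> UNIV \<rightarrow>\<^sub>E UNIV \<and> inj_on f UNIV}"
  have *: "symmetrized_lift (\<Prod>s\<in>UNIV. at_index (u s) (f s) :: ('m \<times> 'n, 'k) mpoly) = elim_t1 CARD('n) (Psi_on UNIV u)"
    if f: "f \<in> ?I" for f
  proof -
    have bij: "bij f" using f by (auto simp: bij_def finite_UNIV_inj_surj)
    then have "Psi_on UNIV u = (Psi_on UNIV (u \<circ> inv_into UNIV f) :: ('m monom, 'k) mpoly)"
      using Psi_on_image[of UNIV "inv_into UNIV f" u] by (simp add: bij_imp_bij_inv bij_is_inj bij_is_surj)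
    then show ?thesis
      unfolding prod_at_index_bij[OF bij] symmetrized_lift_def linear_ext_single by simp
  qed
  have "symmetrized_lift (phi (elim_t1 CARD('n) (Psi_on UNIV u)) :: ('m \<times> 'n, 'k) mpoly)
      = symmetrized_lift (mconst ((-1) ^ CARD('n)) * (\<Sum>f\<in>?I. \<Prod>s\<in>UNIV. at_index (u s) (f s)))"
    by (simp add: phi_elim_t1 phi_Psi_on mconst_neg_one_power)
  also have "\<dots> = mconst ((-1) ^ CARD('n)) * (\<Sum>f\<in>?I. symmetrized_lift (\<Prod>s\<in>UNIV. at_index (u s) (f s)))"
    unfolding symmetrized_lift_def linear_ext_mconst_mult linear_ext_sum ..
  also have "\<dots> = mconst ((-1) ^ CARD('n)) * (of_nat (fact CARD('n)) * elim_t1 CARD('n) (Psi_on UNIV u))"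
    using card_inj_UNIV[where 'n = 'n] by (simp add: *)
  finally show ?thesis by (simp add: mconst_of_nat mult_ac)
qed

section \<open>The kernel of \<open>\<phi>\<close>\<close>

lemma of_nat_neq_0_if_dvd: "d dvd k \<Longrightarrow> of_nat k \<noteq> (0 :: 'k::semiring_1) \<Longrightarrow> of_nat d \<noteq> (0 :: 'k)"
  by (auto elim!: dvdE)

text \<open>The factors are \<open>- (n - k)\<close>, and each \<open>n - k\<close> divides
  \<open>n!\<close>.\<close>

lemma prod_of_nat_diff_neq_0:
  assumes "of_nat (fact n) \<noteq> (0 :: 'k::field)"
  shows "(\<Prod>k<n. of_nat k - of_nat n :: 'k) \<noteq> 0"
proof -
  have "of_nat k - of_nat n \<noteq> (0 :: 'k)" if "k < n" for k
  proof -
    have "(n - k) dvd fact n" using that by (intro dvd_fact) auto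
    then have "of_nat (n - k) \<noteq> (0 :: 'k)" using assms by (rule of_nat_neq_0_if_dvd)
    then show ?thesis using that by (simp add: of_nat_diff)
  qed
  then show ?thesis by (simp add: prod_zero_iff)
qed

text \<open>Modulo an ideal containing all \<open>\<Psi>(w\<^sub>1,\<dots>,w\<^bsub>n+1\<^esub>)\<close>, the polynomial ring is spanned by the
  elements \<open>\<Psi>(u\<^sub>1,\<dots>,u\<^sub>n)\<close> with some \<open>u\<^sub>j\<close> possibly equal to \<open>1\<close>, because
  \<open>t(w) \<Psi>(u\<^sub>1,\<dots>,u\<^sub>n)\<close> can be rewritten by the recursion.\<close>

lemma Fq_spanned_modulo_Psi:
  fixes J :: "('m monom, 'k::field) mpoly set"
  assumes J: "ideal J (Fq q)"
    and Psi_J: "\<And>v :: 'n::finite option \<Rightarrow> 'm monom. (\<And>s. v s \<in> Mq q) \<Longrightarrow> Psi_on UNIV v \<in> J"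
    and n: "of_nat (fact CARD('n)) \<noteq> (0 :: 'k)"
    and f: "f \<in> carrier (Fq q)"
  shows "f \<in> module.span (\<lambda>c f. mconst c * f)
    ({elim_t1 CARD('n) (Psi_on UNIV u) | u :: 'n \<Rightarrow> 'm monom. \<forall>j. q dvd mdeg (u j)} \<union> J)"
proof -
  interpret V: Modules.module "\<lambda>(c::'k) (f::('m monom, 'k) mpoly). mconst c * f" by (rule module_mpoly)
  interpret J: ideal J "Fq q" by (rule J)
  let ?G = "\<lambda>u :: 'n \<Rightarrow> 'm monom. elim_t1 CARD('n) (Psi_on UNIV u) :: ('m monom, 'k) mpoly"
  define X where "X = {?G u | u. \<forall>j. q dvd mdeg (u j)}"
  define D where "D = V.span (X \<union> J)"
  have G: "?G u \<in> D" if "\<And>j. q dvd mdeg (u j)" for u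
    unfolding D_def using that by (intro V.span_base) (auto simp: X_def)
  have J_D: "g \<in> D" if "g \<in> J" for g
    unfolding D_def using that by (intro V.span_base) auto
  have mvar_G: "mvar w * ?G u \<in> D" if w: "w \<in> Mq q" and u: "\<And>j. q dvd mdeg (u j)" for w u
  proof -
    \<comment> \<open>The extra index \<open>None\<close> carries \<open>w\<close>, so splitting it
      off in the recursion produces the product with \<open>mvar w\<close>.\<close>
    define v where "v = case_option w u"
    have v: "q dvd mdeg (v s)" for s using w u by (cases s) (auto simp: v_def Mq_iff)
    have Some: "Psi_on (range Some) v' = (Psi_on UNIV (v' \<circ> Some) :: ('m monom, 'k) mpoly)" for v' :: "'n option \<Rightarrow> 'm monom"
      by (rule Psi_on_image) simp_all
    have "v \<circ> Some = u" "v(Some j := v (Some j) + w) \<circ> Some = u(j := u j + w)" for j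
      by (auto simp: v_def)
    then have "Psi_on UNIV v = - (mvar w * Psi_on UNIV u) + (\<Sum>j\<in>UNIV. Psi_on UNIV (u(j := u j + w)) :: ('m monom, 'k) mpoly)"
      using Psi_on_insert[of "range Some" None v, where 'k = 'k]
      by (simp add: UNIV_option_conv[symmetric] Some sum.reindex) (simp add: v_def)
    then have *: "elim_t1 CARD('n) (Psi_on UNIV v) = - (mvar w * ?G u) + (\<Sum>j\<in>UNIV. ?G (u(j := u j + w)))"
      using w by (simp add: elim_t1_simps Mq_def)
    have "elim_t1 CARD('n) (Psi_on UNIV v) \<in> D"
    proof (cases "\<forall>s. v s \<in> Mq q")
      case True
      then have P: "Psi_on UNIV v \<in> J" by (intro Psi_J) auto
      then have "elim_t1 CARD('n) (Psi_on UNIV v) = (Psi_on UNIV v :: ('m monom, 'k) mpoly)"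
        by (intro elim_t1_id[OF J.Icarr])
      then show ?thesis using P J_D by simp
    next
      case False
      then obtain s where s: "v s = 0" using v by (auto simp: Mq_def)
      \<comment> \<open>Exactly \<open>n\<close> arguments remain besides the trivial one, so the
        factor from \<open>elim_t1_Psi_on_insert_0\<close> is \<open>n - n = 0\<close>.\<close>
      have "card (- {s}) = CARD('n)" by (simp add: Compl_eq_Diff_UNIV card_Diff_singleton card_option)
      then have "elim_t1 CARD('n) (Psi_on (insert s (- {s})) v) = (0 :: ('m monom, 'k) mpoly)"
        using s by (subst elim_t1_Psi_on_insert_0) auto
      moreover have "insert s (- {s}) = UNIV" by auto
      ultimately show ?thesis by (simp add: D_def V.span_zero)
    qed
    moreover have "(\<Sum>j\<in>UNIV. ?G (u(j := u j + w))) \<in> D"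
      using w u G unfolding D_def by (intro V.span_sum) (auto simp: mdeg_add Mq_iff)
    ultimately have "(\<Sum>j\<in>UNIV. ?G (u(j := u j + w))) - elim_t1 CARD('n) (Psi_on UNIV v) \<in> D"
      unfolding D_def by (intro V.span_diff)
    then show ?thesis unfolding * by simp
  qed
  have mvar: "mvar w * g \<in> D" if w: "w \<in> Mq q" and g: "g \<in> D" for w g
    using g[unfolded D_def]
  proof (induction rule: V.span_induct)
    case base
    show ?case
      by (rule V.subspaceI) (auto simp: D_def distrib_left mult.left_commute[of "mvar w"] V.span_zero V.span_add V.span_scale)
  next
    case (step g)
    then show ?case
    proof
      assume "g \<in> X"
      then show ?thesis using w mvar_G by (auto simp: X_def)
    next
      assume "g \<in> J"
      then show ?thesis using J.I_l_closed[OF _ Fq_mvar[OF w]] J_D by (simp add: Fq_ops)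
    qed
  qed
  have one: "1 \<in> D"
  proof -
    \<comment> \<open>With all arguments trivial, \<open>?G\<close> is the constant
      \<open>?c\<close>, which is invertible by the hypothesis on \<open>n!\<close>; dividing by it
      puts 1 into the span.\<close>
    let ?c = "\<Prod>k<CARD('n). of_nat k - of_nat CARD('n) :: 'k"
    have "?G (\<lambda>_. 0) = mconst ?c" by (simp add: elim_t1_Psi_on_0)
    then have "mconst (1 / ?c) * ?G (\<lambda>_. 0) = mconst (1 / ?c * ?c)" by (simp only: mconst_simps)
    also have "\<dots> = 1" using prod_of_nat_diff_neq_0[OF n] by simp
    finally have "mconst (1 / ?c) * ?G (\<lambda>_. 0) = 1" .
    moreover have "mconst (1 / ?c) * ?G (\<lambda>_. 0) \<in> D"
      using G[of "\<lambda>_. 0"] unfolding D_def by (intro V.span_scale) auto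
    ultimately show ?thesis by simp
  qed
  have pow: "mvar w ^ k * g \<in> D" if "w \<in> Mq q" "g \<in> D" for w k g
    using that by (induction k) (auto simp: mult.assoc intro: mvar)
  have "(\<Prod>w\<in>A. mvar w ^ e w) \<in> D" if "finite A" "A \<subseteq> Mq q" for A and e :: "'m monom \<Rightarrow> nat"
    using that by (induction A rule: finite_induct) (auto intro: one pow)
  then have "Poly_Mapping.single a 1 \<in> D" if "a \<in> Poly_Mapping.keys f" for a
    using that f unfolding carrier_Fq prod_mvar_power[symmetric] by auto
  then have "(\<Sum>a\<in>Poly_Mapping.keys f. mconst (Poly_Mapping.lookup f a) * Poly_Mapping.single a 1) \<in> D"
    unfolding D_def by (intro V.span_sum V.span_scale)
  then have "f \<in> D"
    by (simp add: sum_monomials flip: single_eq_mconst_mult)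
  then show ?thesis unfolding D_def X_def .
qed

text \<open>The normalized lift after \<open>phi\<close> is a linear map \<open>E\<close> that fixes
  the elements with \<open>n\<close> arguments and kills \<open>J\<close>. The condition
  \<open>f - E f \<in> J\<close> is linear in \<open>f\<close> and holds on the spanning set, hence
  everywhere; on the kernel \<open>E f = 0\<close>.\<close>

lemma kernel_subset_ideal:
  fixes J :: "('m monom, 'k::field) mpoly set"
  assumes J: "ideal J (Fq q)"
    and Psi_J: "\<And>v :: 'n::finite option \<Rightarrow> 'm monom. (\<And>s. v s \<in> Mq q) \<Longrightarrow> Psi_on UNIV v \<in> J"
    and phi_J: "\<And>g. g \<in> J \<Longrightarrow> phi g = (0 :: ('m \<times> 'n, 'k) mpoly)"
    and n: "of_nat (fact CARD('n)) \<noteq> (0 :: 'k)"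
    and f: "f \<in> carrier (Fq q)" "phi f = (0 :: ('m \<times> 'n, 'k) mpoly)"
  shows "f \<in> J"
proof -
  interpret V: Modules.module "\<lambda>(c::'k) (f::('m monom, 'k) mpoly). mconst c * f" by (rule module_mpoly)
  interpret J: ideal J "Fq q" by (rule J)
  have J_closed: "0 \<in> J" "g \<in> J \<Longrightarrow> h \<in> J \<Longrightarrow> g + h \<in> J" "g \<in> J \<Longrightarrow> mconst c * g \<in> J" for g h c
    using additive_subgroup.zero_closed[OF J.additive_subgroup_axioms]
      additive_subgroup.a_closed[OF J.additive_subgroup_axioms, of g h] J.I_l_closed[of g "mconst c"] Fq_mconst[of c q] by (simp_all add: Fq_ops)
  define c :: 'k where "c = (-1) ^ CARD('n) * of_nat (fact CARD('n))"
  have c: "c \<noteq> 0" using n by (simp add: c_def)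
  define E where "E g = mconst (1 / c) * symmetrized_lift (phi g :: ('m \<times> 'n, 'k) mpoly)" for g
  have E: "E (g + h) = E g + E h" "E (mconst a * g) = mconst a * E g" "E 0 = 0" for g h a
    by (simp_all add: E_def phi_simps phi_mconst symmetrized_lift_def linear_ext_add linear_ext_mconst_mult algebra_simps)
  have "f \<in> V.span ({elim_t1 CARD('n) (Psi_on UNIV u) | u :: 'n \<Rightarrow> 'm monom. \<forall>j. q dvd mdeg (u j)} \<union> J)"
    using J Psi_J n f(1) by (rule Fq_spanned_modulo_Psi)
  then have "f - E f \<in> J"
  proof (induction rule: V.span_induct)
    case base
    have E_diff: "g + h - E (g + h) = (g - E g) + (h - E h)" "mconst a * g - E (mconst a * g) = mconst a * (g - E g)" for g h a
      by (simp_all add: E right_diff_distrib)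
    then show ?case
      using J_closed by (intro V.subspaceI) (simp_all only: mem_Collect_eq E_diff, simp add: E)
  next
    case (step g)
    then show ?case
    proof
      assume "g \<in> J"
      then show ?thesis using phi_J by (simp add: E_def symmetrized_lift_def)
    next
      assume "g \<in> {elim_t1 CARD('n) (Psi_on UNIV u) | u :: 'n \<Rightarrow> 'm monom. \<forall>j. q dvd mdeg (u j)}"
      then obtain u :: "'n \<Rightarrow> 'm monom" where g: "g = elim_t1 CARD('n) (Psi_on UNIV u)" by auto
      have "E g = mconst (1 / c) * (mconst c * g)"
        unfolding g E_def symmetrized_lift_phi c_def ..
      also have "\<dots> = mconst (1 / c * c) * g" by (simp only: mconst_simps mult.assoc)
      finally show ?thesis using c J_closed(1) by simp
    qed
  qed
  then show ?thesis using f(2) by (simp add: E_def symmetrized_lift_def)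
qed

text \<open>The generators lie in the kernel because \<open>n + 1\<close> arguments cannot occupy
  distinct columns. The converse is \<open>kernel_subset_ideal\<close> for the ideal they
  generate.\<close>

lemma kernel_phi:
  assumes n: "of_nat (fact CARD('n::finite)) \<noteq> (0 :: 'k::field)"
  shows "a_kernel (Fq q) (invariant_ring (Gnq q :: ('k^'n^'n) set))
             (phi :: ('m monom, 'k) mpoly \<Rightarrow> ('m \<times> 'n, 'k) mpoly)
           = Idl\<^bsub>Fq q\<^esub> {Psi (CARD('n) + 1) w | w. \<forall>i\<in>{1..CARD('n) + 1}. w i \<in> Mq q}"
    (is "?K = Idl\<^bsub>Fq q\<^esub> ?P")
proof -
  interpret F: cring "Fq q :: ('m monom, 'k) mpoly ring" by (rule Fq_cring)
  interpret R: cring "invariant_ring (Gnq q :: ('k^'n^'n) set) :: ('m \<times> 'n, 'k) mpoly ring"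
    by (rule invariant_ring_cring)
  interpret ring_hom_ring "Fq q" "invariant_ring (Gnq q :: ('k^'n^'n) set)"
      "phi :: ('m monom, 'k) mpoly \<Rightarrow> ('m \<times> 'n, 'k) mpoly"
    by (rule ring_hom_ringI2[OF F.ring_axioms R.ring_axioms phi_hom])
  have K: "?K = {f \<in> carrier (Fq q). phi f = (0 :: ('m \<times> 'n, 'k) mpoly)}"
    by (simp only: a_kernel_def' invariant_ring_def ring_on_simps)
  have P: "?P \<subseteq> ?K"
  proof clarify
    fix w :: "nat \<Rightarrow> 'm monom" assume "\<forall>i\<in>{1..CARD('n) + 1}. w i \<in> Mq q"
    then have "Psi (CARD('n) + 1) w \<in> carrier (Fq q :: ('m monom, 'k) mpoly ring)"
      by (intro Psi_in_Fq) blast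
    moreover have "phi (Psi (CARD('n) + 1) w) = (0 :: ('m \<times> 'n, 'k) mpoly)"
      unfolding Psi_eq_Psi_on by (rule phi_Psi_on_eq_0) simp_all
    ultimately show "Psi (CARD('n) + 1) w \<in> ?K" by (simp only: K mem_Collect_eq)
  qed
  have "?P \<subseteq> carrier (Fq q)" using P K by blast
  then have I: "ideal (Idl\<^bsub>Fq q\<^esub> ?P) (Fq q)" by (rule F.genideal_ideal)
  have IK: "Idl\<^bsub>Fq q\<^esub> ?P \<subseteq> ?K"
    using P kernel_is_ideal by (intro F.genideal_minimal)
  have "Psi_on UNIV v \<in> Idl\<^bsub>Fq q\<^esub> ?P" if v: "\<And>s. v s \<in> Mq q" for v :: "'n option \<Rightarrow> 'm monom"
  proof -
    \<comment> \<open>Numbering the \<open>n + 1\<close> elements of \<open>'n option\<close> turns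
      \<open>Psi_on UNIV v\<close> into one of the generators.\<close>
    obtain p where p: "bij_betw p {1..CARD('n) + 1} (UNIV :: 'n option set)"
      using finite_same_card_bij[of "{1..CARD('n) + 1}" "UNIV :: 'n option set"] by (auto simp: card_option)
    then have "Psi_on UNIV v = (Psi (CARD('n) + 1) (v \<circ> p) :: ('m monom, 'k) mpoly)"
      using Psi_on_image[of "{1..CARD('n) + 1}" p v] by (simp add: Psi_eq_Psi_on bij_betw_def)
    then have "(Psi_on UNIV v :: ('m monom, 'k) mpoly) \<in> ?P" using v by auto
    then show ?thesis using F.genideal_self[OF \<open>?P \<subseteq> carrier (Fq q)\<close>] by blast
  qed
  then have "?K \<subseteq> Idl\<^bsub>Fq q\<^esub> ?P"
    using kernel_subset_ideal[OF I, where 'n = 'n] n IK by (auto simp: K)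
  with IK show ?thesis by blast
qed

section \<open>Invariants of \<open>G(n,q)\<close>\<close>

text \<open>Described by rows, so that its pullback sends the variable \<open>(i, j)\<close> to
  \<open>c j\<close> times the variable \<open>(i, p j)\<close>.\<close>

definition monomial_mat :: "('n \<Rightarrow> 'n) \<Rightarrow> ('n \<Rightarrow> 'k) \<Rightarrow> 'k::field^'n^'n" where
  "monomial_mat p c = (\<chi> j k. if k = p j then c j else 0)"

lemma monomial_mat_in_Gnq:
  fixes p :: "'n::finite \<Rightarrow> 'n"
  assumes p: "bij p" and c: "\<And>j. c j ^ q = 1" and q: "q \<ge> 1"
  shows "monomial_mat p c \<in> Gnq q"
proof -
  have c0: "c j \<noteq> 0" for j using c[of j] q by (auto simp: power_0_left)
  define r where "r = inv_into UNIV p"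
  have r: "k = p j \<longleftrightarrow> j = r k" for j k
    using p unfolding r_def by (metis bij_inv_eq_iff)
  have *: "(\<Sum>j\<in>UNIV. (if k = p j then 1 / c j else 0) * (if l = p j then c j else 0)) = (if k = l then 1 else 0)" for k l
  proof -
    have "(\<Sum>j\<in>UNIV. (if k = p j then 1 / c j else 0) * (if l = p j then c j else 0))
        = (\<Sum>j\<in>UNIV. if j = r k then (if k = l then 1 else 0) else 0)"
      by (intro sum.cong refl) (use c0 in \<open>auto simp: r\<close>, metis r)
    then show ?thesis by simp
  qed
  have **: "(\<Sum>k\<in>UNIV. (if k = p i then c i else 0) * (if k = p j then 1 / c j else 0)) = (if i = j then 1 else 0)" for i j
  proof -
    have "(\<Sum>k\<in>UNIV. (if k = p i then c i else 0) * (if k = p j then 1 / c j else 0))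
        = (\<Sum>k\<in>UNIV. if k = p i then (if i = j then 1 else 0) else 0)"
      by (intro sum.cong refl) (use c0 p in \<open>auto simp: bij_def inj_eq\<close>)
    then show ?thesis by simp
  qed
  \<comment> \<open>The inverse is the transpose with all non-zero entries inverted.\<close>
  have "invertible (monomial_mat p c)"
    unfolding invertible_def
    by (rule exI[of _ "\<chi> k j. if k = p j then 1 / c j else 0"])
      (simp add: monomial_mat_def matrix_matrix_mult_def mat_def vec_eq_iff * **)
  moreover have "monomial_matrix (monomial_mat p c)"
  proof -
    have "monomial_mat p c $ j $ k \<noteq> 0 \<longleftrightarrow> k = p j" for j k
      using c0 by (simp add: monomial_mat_def)
    moreover have "\<exists>!j. k = p j" for k by (simp add: r)
    ultimately show ?thesis by (simp add: monomial_matrix_def)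
  qed
  ultimately show ?thesis
    using c by (auto simp: Gnq_def monomial_mat_def)
qed

lemma mconst_prod: "mconst (prod g A) = (\<Prod>x\<in>A. mconst (g x :: 'k::comm_ring_1))"
  by (induction A rule: infinite_finite_induct) simp_all

lemma pullback_at_index:
  "pullback (monomial_mat p c) (at_index w j) = mconst (c j ^ mdeg w) * at_index w (p j)"
proof -
  have row: "(\<Sum>k\<in>UNIV. mconst (monomial_mat p c $ j $ k) * mvar (i, k)) = mconst (c j) * mvar (i, p j)" for i
  proof -
    have "(\<Sum>k\<in>UNIV. mconst (monomial_mat p c $ j $ k) * mvar (i, k))
        = (\<Sum>k\<in>UNIV. if k = p j then mconst (c j) * mvar (i, p j) else 0)"
      by (intro sum.cong) (auto simp: monomial_mat_def)
    then show ?thesis by simp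
  qed
  have "pullback (monomial_mat p c) (at_index w j)
      = (\<Prod>i\<in>Poly_Mapping.keys w. (mconst (c j) * mvar (i, p j)) ^ Poly_Mapping.lookup w i)"
    by (simp add: pullback_def at_index_def msubst_prod msubst_power msubst_mvar row)
  then show ?thesis
    by (simp add: power_mult_distrib prod.distrib at_index_def mdeg_def power_sum mconst_power mconst_prod)
qed

text \<open>Each monomial is split into its columns. Two cases are used: \<open>p = id\<close> for
  diagonal matrices and \<open>c = 1\<close> for permutation matrices.\<close>

lemma pullback_monomial_mat:
  fixes f :: "('m \<times> 'n::finite, 'k::field) mpoly"
  shows "pullback (monomial_mat p c) f = (\<Sum>a\<in>Poly_Mapping.keys f. mconst (Poly_Mapping.lookup f a)
    * (mconst (\<Prod>j\<in>UNIV. c j ^ mdeg (column_monom a j)) * (\<Prod>j\<in>UNIV. at_index (column_monom a j) (p j))))"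
proof -
  have "pullback (monomial_mat p c) (Poly_Mapping.single a 1)
      = mconst (\<Prod>j\<in>UNIV. c j ^ mdeg (column_monom a j)) * (\<Prod>j\<in>UNIV. at_index (column_monom a j) (p j))" for a :: "('m \<times> 'n) monom"
  proof -
    have "pullback (monomial_mat p c) (\<Prod>j\<in>UNIV. at_index (column_monom a j) j)
        = (\<Prod>j\<in>UNIV. pullback (monomial_mat p c) (at_index (column_monom a j) j))"
      unfolding pullback_def by (rule msubst_prod)
    then show ?thesis
      by (simp add: pullback_at_index prod.distrib mconst_prod prod_at_index)
  qed
  moreover have "pullback A f = (\<Sum>a\<in>Poly_Mapping.keys f. mconst (Poly_Mapping.lookup f a) * pullback A (Poly_Mapping.single a 1))"
    for A :: "'k^'n^'n"
    unfolding pullback_def msubst_single msubst_def[of _ f] by simp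
  ultimately show ?thesis by simp
qed

lemma dvd_if_primitive_root_power_eq_1:
  assumes "primitive_root_of_unity q \<zeta>" "\<zeta> ^ d = 1" "q \<ge> 1"
  shows "q dvd d"
proof -
  have "\<zeta> ^ d = (\<zeta> ^ q) ^ (d div q) * \<zeta> ^ (d mod q)"
    by (simp flip: power_mult power_add)
  then have "\<zeta> ^ (d mod q) = 1" using assms by (simp add: primitive_root_of_unity_def)
  moreover have "d mod q < q" using assms(3) by simp
  ultimately have "d mod q = 0" using assms(1) by (auto simp: primitive_root_of_unity_def)
  then show ?thesis by auto
qed

lemma carrier_invariant_ring: "carrier (invariant_ring G) = {f. \<forall>A\<in>G. pullback A f = f}"
  by (simp add: invariant_ring_def)

text \<open>The diagonal matrix with \<zeta> in position \<open>j\<close> and 1 elsewhere multiplies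
  a monomial by \<zeta> to the degree of its column \<open>j\<close>. Comparing coefficients of
  \<open>a\<close>, this power is 1.\<close>

lemma invariant_dvd_mdeg_column:
  fixes f :: "('m \<times> 'n::finite, 'k::field) mpoly"
  assumes q: "q \<ge> 1" and \<zeta>: "primitive_root_of_unity q (\<zeta> :: 'k)"
    and f: "f \<in> carrier (invariant_ring (Gnq q :: ('k^'n^'n) set))"
    and a: "a \<in> Poly_Mapping.keys f"
  shows "q dvd mdeg (column_monom a j)"
proof -
  define c where "c i = (if i = j then \<zeta> else 1)" for i
  have "c i ^ q = 1" for i using \<zeta> by (simp add: c_def primitive_root_of_unity_def)
  then have "monomial_mat id c \<in> (Gnq q :: ('k^'n^'n) set)"
    using q by (intro monomial_mat_in_Gnq) auto
  then have "f = pullback (monomial_mat id c) f"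
    using f by (simp add: carrier_invariant_ring)
  also have "\<dots> = (\<Sum>b\<in>Poly_Mapping.keys f. mconst (Poly_Mapping.lookup f b) * (mconst (\<zeta> ^ mdeg (column_monom b j)) * Poly_Mapping.single b 1))"
  proof -
    have "c i ^ mdeg (column_monom b i) = (if i = j then \<zeta> ^ mdeg (column_monom b j) else 1)" for i and b :: "('m \<times> 'n) monom"
      by (simp add: c_def)
    then show ?thesis unfolding pullback_monomial_mat by (simp add: prod_at_index)
  qed
  also have "\<dots> = (\<Sum>b\<in>Poly_Mapping.keys f. Poly_Mapping.single b (Poly_Mapping.lookup f b * \<zeta> ^ mdeg (column_monom b j)))"
    by (simp add: mconst_def mult_single)
  finally have "Poly_Mapping.lookup f a = Poly_Mapping.lookup (\<Sum>b\<in>Poly_Mapping.keys f. Poly_Mapping.single b (Poly_Mapping.lookup f b * \<zeta> ^ mdeg (column_monom b j))) a"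
    by (rule arg_cong)
  also have "\<dots> = Poly_Mapping.lookup f a * \<zeta> ^ mdeg (column_monom a j)"
    using a by (simp add: lookup_sum lookup_single when_def)
  finally have "\<zeta> ^ mdeg (column_monom a j) = 1" using a by (auto simp: in_keys_iff)
  then show ?thesis using \<zeta> q by (intro dvd_if_primitive_root_power_eq_1)
qed

text \<open>Summing over the permutation matrices writes \<open>n! f\<close> as a combination of
  sums over column permutations, each of which is, up to sign, \<open>phi\<close> of
  \<open>Psi\<close> at the columns of a monomial. Column degrees are divisible by \<open>q\<close>,
  so these preimages lie in \<open>Fq q\<close>.\<close>

lemma phi_surj:
  fixes f :: "('m \<times> 'n::finite, 'k::field) mpoly"
  assumes q: "q \<ge> 1" and \<zeta>: "primitive_root_of_unity q (\<zeta> :: 'k)"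
    and n: "of_nat (fact CARD('n)) \<noteq> (0 :: 'k)"
    and f: "f \<in> carrier (invariant_ring (Gnq q :: ('k^'n^'n) set))"
  shows "\<exists>g\<in>carrier (Fq q). phi g = f"
proof -
  let ?I = "{p :: 'n \<Rightarrow> 'n. p \<in> UNIV \<rightarrow>\<^sub>E UNIV \<and> inj_on p UNIV}"
  let ?N = "of_nat (fact CARD('n)) :: 'k"
  let ?G = "\<lambda>a. elim_t1 CARD('n) (Psi_on UNIV (column_monom a)) :: ('m monom, 'k) mpoly"
  \<comment> \<open>The factor \<open>1 / ?N\<close> undoes the count of permutations, and
    \<open>(-1)^n\<close> the sign in \<open>phi_Psi_on\<close>.\<close>
  define g where "g = (\<Sum>a\<in>Poly_Mapping.keys f. mconst (1 / ?N * (Poly_Mapping.lookup f a * (-1) ^ CARD('n))) * ?G a)"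
  have orbit: "(\<Sum>p\<in>?I. \<Prod>j\<in>UNIV. at_index (column_monom a j) (p j)) = mconst ((-1) ^ CARD('n)) * (phi (?G a) :: ('m \<times> 'n, 'k) mpoly)" for a
    unfolding phi_elim_t1 phi_Psi_on[OF finite] mconst_neg_one_power by simp
  have fp: "f = (\<Sum>a\<in>Poly_Mapping.keys f. mconst (Poly_Mapping.lookup f a) * (\<Prod>j\<in>UNIV. at_index (column_monom a j) (p j)))"
    if "p \<in> ?I" for p
  proof -
    have "bij p" using that by (auto simp: bij_def finite_UNIV_inj_surj)
    then have "pullback (monomial_mat p (\<lambda>_. 1)) f = f"
      using f q by (auto simp: carrier_invariant_ring intro!: monomial_mat_in_Gnq)
    then show ?thesis unfolding pullback_monomial_mat by simp
  qed
  have "mconst ?N * f = (\<Sum>p\<in>?I. f)"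
    using card_inj_UNIV[where 'n = 'n] by (simp add: mconst_of_nat)
  also have "\<dots> = (\<Sum>p\<in>?I. \<Sum>a\<in>Poly_Mapping.keys f. mconst (Poly_Mapping.lookup f a) * (\<Prod>j\<in>UNIV. at_index (column_monom a j) (p j)))"
    using fp by (intro sum.cong) auto
  also have "\<dots> = (\<Sum>a\<in>Poly_Mapping.keys f. mconst (Poly_Mapping.lookup f a) * (\<Sum>p\<in>?I. \<Prod>j\<in>UNIV. at_index (column_monom a j) (p j)))"
    by (subst sum.swap) (simp add: sum_distrib_left)
  also have "\<dots> = (\<Sum>a\<in>Poly_Mapping.keys f. mconst (Poly_Mapping.lookup f a * (-1) ^ CARD('n)) * phi (?G a))"
    by (simp only: orbit mconst_simps mult.assoc)
  finally have "mconst (1 / ?N) * (mconst ?N * f) = phi g"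
    by (simp only: g_def phi_simps phi_mconst mconst_simps sum_distrib_left mult.assoc)
  moreover have "mconst (1 / ?N) * (mconst ?N * f) = mconst (1 / ?N * ?N) * f"
    by (simp only: mconst_simps mult.assoc)
  ultimately have "phi g = f" using n by simp
  moreover have "g \<in> carrier (Fq q)"
    unfolding g_def using invariant_dvd_mdeg_column[OF q \<zeta> f]
    by (intro Fq_sum Fq_mult Fq_mconst elim_t1_Psi_on_in_Fq) auto
  ultimately show ?thesis by blast
qed

section \<open>Degree bound and minimality\<close>

lemma monom_split: "d \<le> mdeg w \<Longrightarrow> \<exists>u v. w = u + v \<and> mdeg u = d"
proof (induction d)
  case 0
  show ?case by (rule exI[of _ 0]) simp
next
  case (Suc d)
  then obtain u v where uv: "w = u + v" "mdeg u = d" by auto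
  then have "mdeg v \<noteq> 0" using Suc.prems by (auto simp: mdeg_add)
  then obtain x where x: "Poly_Mapping.lookup v x \<noteq> 0" by (auto simp: mdeg_def)
  let ?e = "Poly_Mapping.single x (1 :: nat)"
  have "v = ?e + (v - ?e)"
    using x by (intro poly_mapping_eqI) (auto simp: lookup_add lookup_minus lookup_single when_def)
  then have "w = (u + ?e) + (v - ?e)" using uv(1) by (simp add: add.assoc)
  moreover have "mdeg (u + ?e) = Suc d" by (simp add: mdeg_add uv(2)) (simp add: mdeg_def)
  ultimately show ?case by blast
qed

text \<open>Factors of degree exactly \<open>q\<close> are split off one by one; the last index
  receives the rest, whose degree is still a multiple of \<open>q\<close> and at least
  \<open>q\<close>.\<close>

lemma Mq_factorization:
  assumes "finite S" "S \<noteq> {}" "q \<ge> 1" "q dvd mdeg w" "card S * q \<le> mdeg w"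
  shows "\<exists>v. w = (\<Sum>s\<in>S. v s) \<and> (\<forall>s\<in>S. v s \<in> Mq q)"
  using assms
proof (induction S arbitrary: w rule: finite_ne_induct)
  case (singleton a)
  then show ?case by (intro exI[of _ "\<lambda>_. w"]) (auto simp: Mq_iff)
next
  case (insert a S)
  then have "q \<le> mdeg w" by simp
  then obtain u v where uv: "w = u + v" "mdeg u = q" using monom_split by blast
  have "q dvd mdeg v" using insert.prems(2) uv by (simp add: mdeg_add)
  moreover have "card S * q \<le> mdeg v" using insert.prems(3) insert.hyps uv by (simp add: mdeg_add)
  ultimately obtain t where t: "v = (\<Sum>s\<in>S. t s)" "\<forall>s\<in>S. t s \<in> Mq q"
    using insert.IH insert.prems(1) by blast
  have "(\<Sum>s\<in>S. (t(a := u)) s) = (\<Sum>s\<in>S. t s)"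
    using insert.hyps by (intro sum.cong) auto
  then have "w = (\<Sum>s\<in>insert a S. (t(a := u)) s)"
    using insert.hyps uv t by simp
  moreover have "\<forall>s\<in>insert a S. (t(a := u)) s \<in> Mq q"
    using t(2) uv(2) insert.prems(1) by (auto simp: Mq_iff)
  ultimately show ?case by blast
qed

section \<open>Generation in degree at most \<open>nq\<close>\<close>

lemma
  fixes R :: "('x, 'k::comm_ring_1) mpoly ring"
  assumes R: "R = ring_on C"
  shows alg_generated_mconst: "mconst c \<in> alg_generated R S"
    and alg_generated_incl: "f \<in> S \<Longrightarrow> f \<in> alg_generated R S"
    and alg_generated_add: "f \<in> alg_generated R S \<Longrightarrow> g \<in> alg_generated R S \<Longrightarrow> f + g \<in> alg_generated R S"
    and alg_generated_mult: "f \<in> alg_generated R S \<Longrightarrow> g \<in> alg_generated R S \<Longrightarrow> f * g \<in> alg_generated R S"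
  using generate_ring.eng_add[of f R "range mconst \<union> S" g] generate_ring.eng_mult[of f R "range mconst \<union> S" g]
  by (auto simp: alg_generated_def R intro: generate_ring.incl)

lemma alg_generated_sum:
  assumes "R = ring_on C" "\<And>x. x \<in> A \<Longrightarrow> h x \<in> alg_generated R S"
  shows "sum h A \<in> alg_generated R S"
  using assms(2) alg_generated_mconst[OF assms(1), of 0]
  by (induction A rule: infinite_finite_induct) (auto intro: alg_generated_add[OF assms(1)])

lemma alg_generated_prod:
  assumes "R = ring_on C" "\<And>x. x \<in> A \<Longrightarrow> h x \<in> alg_generated R S"
  shows "prod h A \<in> alg_generated R S"
  using assms(2) alg_generated_mconst[OF assms(1), of 1]
  by (induction A rule: infinite_finite_induct) (auto intro: alg_generated_mult[OF assms(1)])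

lemma phi_in_alg_generated:
  assumes R: "R = ring_on C" and "f \<in> carrier (Fq q)" and "\<And>w. w \<in> Mq q \<Longrightarrow> bracket w \<in> alg_generated R S"
  shows "phi f \<in> alg_generated R S"
proof -
  have pow: "h ^ k \<in> alg_generated R S" if "h \<in> alg_generated R S" for h k
    using that alg_generated_mconst[OF R, of 1] by (induction k) (auto intro: alg_generated_mult[OF R])
  then show ?thesis
    unfolding phi_def msubst_def using assms(2,3)
    by (intro alg_generated_sum[OF R] alg_generated_mult[OF R] alg_generated_mconst[OF R] alg_generated_prod[OF R] pow)
      (auto simp: carrier_Fq subset_iff)
qed

text \<open>If \<open>deg w > nq\<close>, then \<open>w = w\<^sub>1 \<dots> w\<^bsub>n+1\<^esub>\<close> with all \<open>w\<^sub>i\<close> in \<open>M(q)\<close>, and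
  \<open>\<Psi>(w\<^sub>1,\<dots>,w\<^bsub>n+1\<^esub>)\<close> is \<open>- n! t(w)\<close> plus products of \<open>t(v)\<close> with \<open>v\<close> of smaller degree.\<close>

lemma bracket_in_alg_generated:
  fixes R :: "('m \<times> 'n::finite, 'k::field) mpoly ring"
  assumes R: "R = ring_on C" and q: "q \<ge> 1" and n: "of_nat (fact CARD('n)) \<noteq> (0 :: 'k)"
    and w: "w \<in> Mq q"
  shows "bracket w \<in> alg_generated R {bracket w | w. w \<in> Mq q \<and> mdeg w \<le> CARD('n) * q}"
    (is "_ \<in> ?A")
  using w
proof (induction "mdeg w" arbitrary: w rule: less_induct)
  case less
  note A = alg_generated_mconst[OF R] alg_generated_sum[OF R] alg_generated_prod[OF R] alg_generated_mult[OF R]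
  have of_nat: "of_nat k \<in> ?A" and sign: "(-1) ^ k \<in> ?A" for k
    using alg_generated_mconst[OF R, of "of_nat k"] alg_generated_mconst[OF R, of "(-1) ^ k"]
    by (simp_all only: mconst_of_nat mconst_neg_one_power)
  show ?case
  proof (cases "mdeg w \<le> CARD('n) * q")
    case True
    then show ?thesis using less.prems by (intro alg_generated_incl[OF R]) auto
  next
    case False
    \<comment> \<open>Starting at 0, this set has \<open>n + 1\<close> elements.\<close>
    define S where "S = {..CARD('n)}"
    have S: "finite S" "S \<noteq> {}" "card S = Suc CARD('n)" by (auto simp: S_def)
    obtain k where k: "mdeg w = q * k" using less.prems by (auto simp: Mq_iff)
    then have "Suc CARD('n) \<le> k" using False by (simp add: mult.commute Suc_le_eq)
    then have "card S * q \<le> mdeg w" using k S(3) by (metis mult.commute mult_le_mono1)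
    then obtain v where v: "w = (\<Sum>s\<in>S. v s)" "\<And>s. s \<in> S \<Longrightarrow> v s \<in> Mq q"
      using Mq_factorization[OF S(1,2) q] less.prems by (auto simp: Mq_iff)
    define T where "T P = (-1) ^ card P * (\<Prod>B\<in>P. of_nat (fact (card B - 1)) * (bracket (\<Sum>s\<in>B. v s) :: ('m \<times> 'n, 'k) mpoly))" for P
    have "phi (Psi_on S v) = (\<Sum>P | partition_on S P. T P)"
      by (simp add: Psi_on_def T_def phi_def msubst_sum msubst_mult msubst_prod msubst_power msubst_uminus msubst_mvar
          msubst_mconst flip: mconst_of_nat mconst_neg_one_power)
    then have "(\<Sum>P | partition_on S P. T P) = 0"
      using S(1,3) by (simp add: phi_Psi_on_eq_0)
    moreover have "(\<Sum>P | partition_on S P. T P) = T {S} + (\<Sum>P\<in>{P. partition_on S P} - {{S}}. T P)"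
      using S by (intro sum.remove finitely_many_partition_on) (auto intro: partition_on_space)
    \<comment> \<open>The one-block partition has sign \<open>-1\<close> and coefficient
      \<open>(card S - 1)! = n!\<close>.\<close>
    moreover have "T {S} = - (of_nat (fact CARD('n)) * bracket w)"
      using S(3) v(1) by (simp add: T_def)
    ultimately have eq: "of_nat (fact CARD('n)) * bracket w = (\<Sum>P\<in>{P. partition_on S P} - {{S}}. T P)"
      by simp
    have "bracket (\<Sum>s\<in>B. v s) \<in> ?A" if P: "partition_on S P" "P \<noteq> {S}" and B: "B \<in> P" for P B
    proof -
      have "B \<subseteq> S" "B \<noteq> {}" using P(1) B by (auto simp: partition_on_def)
      have "B \<noteq> S"
      proof
        assume "B = S"
        have "C = S" if "C \<in> P" for C
        proof (rule ccontr)
          assume "C \<noteq> S"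
          then have "C \<inter> B = {}" using P(1) B that \<open>B = S\<close> by (auto simp: partition_on_def disjoint_def)
          moreover have "C \<subseteq> S" "C \<noteq> {}" using P(1) that by (auto simp: partition_on_def)
          ultimately show False using \<open>B = S\<close> by auto
        qed
        then have "P = {S}" using B by blast
        with P(2) show False by contradiction
      qed
      \<comment> \<open>The arguments outside \<open>B\<close> contribute a monomial of positive
        degree, so the product over \<open>B\<close> has smaller degree than
        \<open>w\<close>.\<close>
      then obtain s where s: "s \<in> S" "s \<notin> B" using \<open>B \<subseteq> S\<close> by auto
      have "mdeg w = mdeg (sum v B) + mdeg (sum v (S - B))"
        unfolding v(1) mdeg_add[symmetric] sum.subset_diff[OF \<open>B \<subseteq> S\<close> S(1), of v] by (simp only: add.commute)
      moreover have "sum v (S - B) \<in> Mq q" using S(1) s v(2) by (intro Mq_sum) auto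
      moreover have "sum v B \<in> Mq q"
        using finite_subset[OF \<open>B \<subseteq> S\<close> S(1)] \<open>B \<noteq> {}\<close> \<open>B \<subseteq> S\<close> v(2) by (intro Mq_sum) auto
      ultimately show ?thesis by (intro less.hyps) (auto simp: Mq_iff)
    qed
    then have "of_nat (fact CARD('n)) * bracket w \<in> ?A"
      unfolding eq T_def by (intro A sign of_nat) auto
    then have "mconst (1 / of_nat (fact CARD('n))) * (of_nat (fact CARD('n)) * bracket w) \<in> ?A"
      by (rule alg_generated_mult[OF R alg_generated_mconst[OF R]])
    moreover have "mconst (1 / of_nat (fact CARD('n))) * (of_nat (fact CARD('n)) * bracket w)
       = mconst (1 / of_nat (fact CARD('n)) * of_nat (fact CARD('n))) * (bracket w :: ('m \<times> 'n, 'k) mpoly)"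
      by (simp only: mconst_simps mconst_of_nat mult.assoc)
    ultimately show ?thesis using n by simp
  qed
qed

section \<open>Weights of relations and minimality\<close>

definition weight :: "('m monom) monom \<Rightarrow> nat" where
  "weight a = (\<Sum>w\<in>Poly_Mapping.keys a. Poly_Mapping.lookup a w * mdeg w)"

text \<open>The weight gives \<open>t(w)\<close> the degree of its image \<open>[w]\<close>. Weights
  are additive and non-negative, so a lower bound survives multiplication by arbitrary
  polynomials.\<close>

definition weight_ge :: "nat \<Rightarrow> ('m monom, 'k::comm_ring_1) mpoly set" where
  "weight_ge d = {f. \<forall>a\<in>Poly_Mapping.keys f. d \<le> weight a}"

lemma weight_superset:
  "finite U \<Longrightarrow> Poly_Mapping.keys a \<subseteq> U \<Longrightarrow> weight a = (\<Sum>w\<in>U. Poly_Mapping.lookup a w * mdeg w)"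
  unfolding weight_def by (intro sum.mono_neutral_left) (auto simp: in_keys_iff)

lemma weight_add: "weight (a + b) = weight a + weight b"
  using Poly_Mapping.keys_add[of a b]
  by (simp add: weight_superset[of "Poly_Mapping.keys a \<union> Poly_Mapping.keys b"] lookup_add sum.distrib distrib_right)

lemma
  shows weight_ge_add: "f \<in> weight_ge d \<Longrightarrow> g \<in> weight_ge d \<Longrightarrow> f + g \<in> weight_ge d"
    and weight_ge_uminus: "f \<in> weight_ge d \<Longrightarrow> - f \<in> weight_ge d"
    and weight_ge_mult: "f \<in> weight_ge d \<Longrightarrow> g \<in> weight_ge e \<Longrightarrow> f * g \<in> weight_ge (d + e)"
    and weight_ge_mvar: "mvar w \<in> weight_ge (mdeg w)"
    and weight_ge_antimono: "f \<in> weight_ge d \<Longrightarrow> e \<le> d \<Longrightarrow> f \<in> weight_ge e"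
    and weight_ge_zero: "0 \<in> weight_ge d"
    and weight_ge_0: "f \<in> weight_ge 0"
proof -
  show "f \<in> weight_ge d \<Longrightarrow> g \<in> weight_ge d \<Longrightarrow> f + g \<in> weight_ge d"
    using Poly_Mapping.keys_add[of f g] by (auto simp: weight_ge_def)
  show "f \<in> weight_ge d \<Longrightarrow> - f \<in> weight_ge d"
    by (auto simp: weight_ge_def in_keys_iff)
  show "f \<in> weight_ge d \<Longrightarrow> g \<in> weight_ge e \<Longrightarrow> f * g \<in> weight_ge (d + e)"
    using keys_mult[of f g] by (fastforce simp: weight_ge_def weight_add intro: add_mono)
qed (auto simp: weight_ge_def weight_def mvar_def)

lemma weight_ge_sum: "(\<And>x. x \<in> A \<Longrightarrow> h x \<in> weight_ge d) \<Longrightarrow> sum h A \<in> weight_ge d"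
  by (induction A rule: infinite_finite_induct) (auto intro: weight_ge_add weight_ge_zero)

text \<open>Every term of the recursion keeps the total degree of the arguments: \<open>w a\<close>
  is either split off as a variable or merged into another argument.\<close>

lemma Psi_on_weight_ge:
  fixes w :: "'i \<Rightarrow> 'm monom"
  assumes "finite S"
  shows "(Psi_on S w :: ('m monom, 'k::comm_ring_1) mpoly) \<in> weight_ge (\<Sum>s\<in>S. mdeg (w s))"
  using assms
proof (induction S arbitrary: w rule: finite_induct)
  case empty
  show ?case by (simp add: weight_ge_0)
next
  case (insert a S)
  have "(Psi_on S (w(s := w s + w a)) :: ('m monom, 'k) mpoly) \<in> weight_ge (\<Sum>s\<in>insert a S. mdeg (w s))" if s: "s \<in> S" for s
  proof -
    have "(\<Sum>t\<in>S. mdeg ((w(s := w s + w a)) t)) = (\<Sum>t\<in>insert a S. mdeg (w t))"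
      using insert.hyps s by (simp add: sum.remove[of S s] mdeg_add)
    then show ?thesis using insert.IH[of "w(s := w s + w a)"] by (simp only:)
  qed
  moreover have "(mvar (w a) * Psi_on S w :: ('m monom, 'k) mpoly) \<in> weight_ge (\<Sum>s\<in>insert a S. mdeg (w s))"
    using weight_ge_mult[OF weight_ge_mvar insert.IH] insert.hyps by simp
  ultimately show ?case
    using insert.hyps unfolding Psi_on_insert[OF insert.hyps]
    by (intro weight_ge_add weight_ge_uminus weight_ge_sum)
qed

text \<open>Additive inverses are unique in the ring, which identifies \<open>\<ominus>\<close> with
  the minus of the type class.\<close>

lemma cring_ring_on_a_inv:
  assumes "cring (ring_on C)" "x \<in> C" "- x \<in> C"
  shows "\<ominus>\<^bsub>ring_on C\<^esub> x = - x"
proof -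
  interpret cring "ring_on C" by fact
  show ?thesis using minus_equality[of "- x" x] assms(2,3) by simp
qed

lemma ideal_weight_ge: "ideal (carrier (Fq q) \<inter> weight_ge d) (Fq q :: ('m monom, 'k::comm_ring_1) mpoly ring)"
proof -
  let ?F = "Fq q :: ('m monom, 'k) mpoly ring"
  interpret F: cring ?F by (rule Fq_cring)
  have mult: "f * g \<in> weight_ge d" "g * f \<in> weight_ge d" if "g \<in> weight_ge d" for f g :: "('m monom, 'k) mpoly"
    using weight_ge_mult[OF weight_ge_0 that] weight_ge_mult[OF that weight_ge_0] by simp_all
  have neg: "\<ominus>\<^bsub>?F\<^esub> f = - f" if "f \<in> carrier ?F" for f
    using cring_ring_on_a_inv[of "carrier ?F" f] that Fq_uminus[OF that] F.is_cring
    by (simp add: Fq_def mpoly_ring_def)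
  show ?thesis
  proof (rule idealI[OF F.ring_axioms])
    show "subgroup (carrier ?F \<inter> weight_ge d) (add_monoid ?F)"
    proof (rule F.add.subgroupI)
      show "carrier ?F \<inter> weight_ge d \<noteq> {}"
        using F.zero_closed by (auto simp: Fq_ops weight_ge_def intro!: exI[of _ 0])
    qed (auto simp: neg Fq_ops[of q] intro: Fq_add Fq_uminus weight_ge_add weight_ge_uminus)
  qed (auto simp: Fq_ops intro: Fq_mult mult)
qed

text \<open>Each of the \<open>n + 1\<close> arguments of a generating relation has degree at least
  \<open>q\<close>, and the polynomials of weight at least \<open>(n + 1) q\<close> form an
  ideal.\<close>

lemma kernel_weight_ge:
  assumes n: "of_nat (fact CARD('n::finite)) \<noteq> (0 :: 'k::field)"
    and f: "f \<in> carrier (Fq q)" "phi f = (0 :: ('m \<times> 'n, 'k) mpoly)"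
  shows "f \<in> weight_ge ((CARD('n) + 1) * q)"
proof -
  let ?P = "{Psi (CARD('n) + 1) w | w. \<forall>i\<in>{1..CARD('n) + 1}. w i \<in> Mq q} :: ('m monom, 'k) mpoly set"
  let ?J = "carrier (Fq q) \<inter> weight_ge ((CARD('n) + 1) * q) :: ('m monom, 'k) mpoly set"
  interpret F: cring "Fq q :: ('m monom, 'k) mpoly ring" by (rule Fq_cring)
  have "?P \<subseteq> ?J"
  proof clarify
    fix w :: "nat \<Rightarrow> 'm monom" assume w: "\<forall>i\<in>{1..CARD('n) + 1}. w i \<in> Mq q"
    have "card {1..CARD('n) + 1} * q \<le> (\<Sum>s\<in>{1..CARD('n) + 1}. mdeg (w s))"
    proof (rule sum_bounded_below[where 'a = nat, unfolded of_nat_id])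
      fix i assume "i \<in> {1..CARD('n) + 1}"
      then have "q dvd mdeg (w i)" "mdeg (w i) \<noteq> 0" using w by (auto simp: Mq_iff)
      then show "q \<le> mdeg (w i)" by (intro dvd_imp_le) auto
    qed
    then have "Psi (CARD('n) + 1) w \<in> weight_ge ((CARD('n) + 1) * q)"
      unfolding Psi_eq_Psi_on by (intro weight_ge_antimono[OF Psi_on_weight_ge]) simp_all
    moreover have "Psi (CARD('n) + 1) w \<in> carrier (Fq q)"
      using w by (intro Psi_in_Fq) blast
    ultimately show "Psi (CARD('n) + 1) w \<in> ?J" by blast
  qed
  then have "Idl\<^bsub>Fq q\<^esub> ?P \<subseteq> ?J"
    by (intro F.genideal_minimal ideal_weight_ge)
  moreover have "f \<in> a_kernel (Fq q) (invariant_ring (Gnq q :: ('k^'n^'n) set)) (phi :: _ \<Rightarrow> ('m \<times> 'n, 'k) mpoly)"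
    using f by (simp only: a_kernel_def' mem_Collect_eq) (simp only: invariant_ring_def ring_on_simps)
  ultimately show ?thesis unfolding kernel_phi[OF n] by blast
qed

text \<open>Turns a redundancy among generators into a polynomial relation: elements generated by
  the \<open>[v]\<close> with \<open>v \<in> Y\<close> are images of polynomials in the
  \<open>t(v)\<close> alone.\<close>

lemma alg_generated_bracket_subset:
  fixes Y :: "'m monom set"
  assumes Y: "Y \<subseteq> Mq q"
    and h: "h \<in> alg_generated (invariant_ring (Gnq q :: ('k::field^'n::finite^'n) set)) (bracket ` Y :: ('m \<times> 'n, 'k) mpoly set)"
  shows "\<exists>f. (\<forall>a\<in>Poly_Mapping.keys f. Poly_Mapping.keys a \<subseteq> Y) \<and> phi f = h"
  using h unfolding alg_generated_def
proof (induction rule: generate_ring.induct)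
  let ?R = "invariant_ring (Gnq q :: ('k^'n^'n) set) :: ('m \<times> 'n, 'k) mpoly ring"
  let ?M = "mpoly_ring Y :: ('m monom, 'k) mpoly ring"
  interpret M: cring ?M by (rule mpoly_ring_cring)
  have M: "carrier ?M = {f. \<forall>a\<in>Poly_Mapping.keys f. Poly_Mapping.keys a \<subseteq> Y}" "f \<oplus>\<^bsub>?M\<^esub> g = f + g" "f \<otimes>\<^bsub>?M\<^esub> g = f * g" for f g
    by (simp_all add: mpoly_ring_def)
  have R: "f \<oplus>\<^bsub>?R\<^esub> g = f + g" "f \<otimes>\<^bsub>?R\<^esub> g = f * g" "\<one>\<^bsub>?R\<^esub> = 1" for f g
    by (simp_all add: invariant_ring_def)
  {
    case one
    show ?case by (rule exI[of _ 1]) (auto simp: R phi_simps)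
  next
    case (incl h)
    then show ?case
    proof
      assume "h \<in> range mconst"
      then obtain c where "h = mconst c" by auto
      then show ?thesis by (intro exI[of _ "mconst c"] conjI) (simp_all add: phi_mconst, auto simp: mconst_def)
    next
      assume "h \<in> bracket ` Y"
      then obtain w where "h = bracket w" "w \<in> Y" by auto
      then show ?thesis by (intro exI[of _ "mvar w"]) (auto simp: phi_mvar, auto simp: mvar_def)
    qed
  next
    case (a_inv h)
    then obtain f where f: "\<forall>a\<in>Poly_Mapping.keys f. Poly_Mapping.keys a \<subseteq> Y" "phi f = h" by auto
    \<comment> \<open>Identifying \<open>\<ominus>\<close> with minus requires \<open>h\<close> and
      \<open>- h\<close> to be invariants, which follows because they are images under
      \<open>phi\<close>.\<close>
    then have "f \<in> carrier (Fq q)" using Y by (auto simp: carrier_Fq)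
    then have "h \<in> carrier ?R" "- h \<in> carrier ?R"
      using phi_hom[of q, where 'n = 'n] f(2) Fq_uminus[of f q]
      by (auto simp: ring_hom_def phi_simps(4)[symmetric] Pi_iff simp del: f(2)) 
    then have "\<ominus>\<^bsub>?R\<^esub> h = - h"
      using cring_ring_on_a_inv[of "carrier ?R" h] invariant_ring_cring[of "Gnq q :: ('k^'n^'n) set"]
      by (simp add: invariant_ring_def)
    then show ?case using f by (intro exI[of _ "- f"]) (auto simp: phi_simps in_keys_iff)
  next
    case (eng_add h1 h2)
    then obtain f g where "f \<in> carrier ?M" "g \<in> carrier ?M" "phi f = h1" "phi g = h2" by (auto simp: M)
    then show ?case using M.a_closed[of f g] by (intro exI[of _ "f + g"]) (auto simp: M R phi_simps)
  next
    case (eng_mult h1 h2)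
    then obtain f g where "f \<in> carrier ?M" "g \<in> carrier ?M" "phi f = h1" "phi g = h2" by (auto simp: M)
    then show ?case using M.m_closed[of f g] by (intro exI[of _ "f * g"]) (auto simp: M R phi_simps)
  }
qed

text \<open>A relation expressing \<open>[w]\<close> by other generators would be an element of the kernel containing
  the monomial \<open>t(w)\<close>, whose degree is too small.\<close>

lemma bracket_not_in_alg_generated:
  assumes n: "of_nat (fact CARD('n::finite)) \<noteq> (0 :: 'k::field)" and q: "q \<ge> 1"
    and w: "w \<in> Mq q" "mdeg w \<le> CARD('n) * q" and Y: "Y \<subseteq> Mq q" "w \<notin> Y"
  shows "(bracket w :: ('m \<times> 'n, 'k) mpoly) \<notin> alg_generated (invariant_ring (Gnq q :: ('k^'n^'n) set)) (bracket ` Y)"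
proof
  assume "(bracket w :: ('m \<times> 'n, 'k) mpoly) \<in> alg_generated (invariant_ring (Gnq q :: ('k^'n^'n) set)) (bracket ` Y)"
  then obtain f :: "('m monom, 'k) mpoly" where f: "\<forall>a\<in>Poly_Mapping.keys f. Poly_Mapping.keys a \<subseteq> Y"
    "phi f = (bracket w :: ('m \<times> 'n, 'k) mpoly)"
    using alg_generated_bracket_subset[OF Y(1)] by blast
  let ?a = "Poly_Mapping.single w (1 :: nat)"
  have "?a \<notin> Poly_Mapping.keys f" using f(1) Y(2) by auto
  then have "Poly_Mapping.lookup (mvar w + - f) ?a = 1"
    by (simp add: lookup_minus mvar_def in_keys_iff)
  then have "?a \<in> Poly_Mapping.keys (mvar w + - f)" by (simp add: in_keys_iff)
  moreover have "mvar w + - f \<in> weight_ge ((CARD('n) + 1) * q)"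
  proof (rule kernel_weight_ge[OF n])
    have "f \<in> carrier (Fq q)" using f(1) Y(1) by (auto simp: carrier_Fq)
    then show "mvar w + - f \<in> carrier (Fq q)" using w(1) by (intro Fq_add Fq_uminus Fq_mvar)
    show "phi (mvar w + - f) = (0 :: ('m \<times> 'n, 'k) mpoly)" using f(2) by (simp add: phi_simps phi_mvar)
  qed
  ultimately have "(CARD('n) + 1) * q \<le> weight ?a" by (auto simp: weight_ge_def)
  \<comment> \<open>This weight is \<open>mdeg w\<close>, at most \<open>nq\<close>, and
    \<open>nq < (n + 1) q\<close> since \<open>q \<ge> 1\<close>.\<close>
  then show False using w(2) q by (simp add: weight_def)
qed

theorem theorem2p5:
  fixes q :: nat
  assumes "q \<ge> 1"
    and "(of_nat (fact CARD('n::finite) * q) :: 'k::field) \<noteq> 0"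
    and "\<exists>\<zeta>::'k. primitive_root_of_unity q \<zeta>"
  shows "a_kernel (Fq q) (invariant_ring (Gnq q :: ('k^'n^'n) set))
             (phi :: ('m::finite monom, 'k) mpoly \<Rightarrow> ('m \<times> 'n, 'k) mpoly)
           = Idl\<^bsub>Fq q\<^esub> {Psi (CARD('n) + 1) w | w. \<forall>i\<in>{1..CARD('n) + 1}. w i \<in> Mq q}
       \<and> (let R = invariant_ring (Gnq q :: ('k^'n^'n) set);
              S = {bracket w | w. w \<in> Mq q \<and> mdeg w \<le> CARD('n) * q} :: ('m \<times> 'n, 'k) mpoly set
          in alg_generated R S = carrier R
             \<and> (\<forall>T. T \<subset> S \<longrightarrow> alg_generated R T \<noteq> carrier R))"
proof -
  define R where "R = (invariant_ring (Gnq q :: ('k^'n^'n) set) :: ('m \<times> 'n, 'k) mpoly ring)"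
  define S where "S = ({bracket w | w. w \<in> Mq q \<and> mdeg w \<le> CARD('n) * q} :: ('m \<times> 'n, 'k) mpoly set)"
  interpret R: cring R unfolding R_def by (rule invariant_ring_cring)
  have R: "R = ring_on (carrier R)" unfolding R_def invariant_ring_def ring_on_simps ..
  have n: "of_nat (fact CARD('n)) \<noteq> (0 :: 'k)"
    using assms(2) by (rule of_nat_neq_0_if_dvd[rotated]) simp
  obtain \<zeta> :: 'k where \<zeta>: "primitive_root_of_unity q \<zeta>" using assms(3) by blast
  have bracket: "bracket w \<in> carrier R" if "w \<in> Mq q" for w
    unfolding R_def carrier_invariant_ring mem_Collect_eq
    using that by (intro ballI pullback_bracket) (auto simp: Mq_def)
  have "alg_generated R S \<subseteq> carrier R"
    unfolding alg_generated_def
  proof (rule R.generate_ring_incl)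
    have "mconst c \<in> carrier R" for c
      by (simp add: R_def carrier_invariant_ring pullback_def msubst_mconst)
    then show "range mconst \<union> S \<subseteq> carrier R" using bracket by (auto simp: S_def)
  qed
  moreover have "carrier R \<subseteq> alg_generated R S"
  proof
    fix f assume "f \<in> carrier R"
    then obtain g where g: "g \<in> carrier (Fq q)" "phi g = f"
      using phi_surj[OF assms(1) \<zeta> n] unfolding R_def by blast
    then show "f \<in> alg_generated R S"
      using phi_in_alg_generated[OF R g(1)] bracket_in_alg_generated[OF R assms(1) n] unfolding S_def by blast
  qed
  moreover have "alg_generated R T \<noteq> carrier R" if T: "T \<subset> S" for T
  proof -
    obtain w where w: "w \<in> Mq q" "mdeg w \<le> CARD('n) * q" "bracket w \<notin> T"
      using T unfolding S_def by blast
    \<comment> \<open>The full preimage of \<open>T\<close> in \<open>Mq q\<close>: its image is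
      \<open>T\<close>, and \<open>bracket w \<notin> T\<close> gives
      \<open>w \<notin> Y\<close>.\<close>
    define Y where "Y = {v \<in> Mq q. bracket v \<in> T}"
    have "T = bracket ` Y" using T by (auto simp: Y_def S_def)
    moreover have "Y \<subseteq> Mq q" "w \<notin> Y" using w(3) by (auto simp: Y_def)
    ultimately have "bracket w \<notin> alg_generated R T"
      unfolding R_def using bracket_not_in_alg_generated[OF n assms(1) w(1,2)] by blast
    then show ?thesis using bracket[OF w(1)] by blast
  qed
  ultimately show ?thesis
    using kernel_phi[OF n] unfolding Let_def R_def S_def by blast
qed

end
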